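(* Let $W\subset\{(\mu,\sigma^2,\alpha_\pi,B)\in\mathbb{R}^4:\sigma^2>0,\ \alpha_\pi>1,\ B<0\}$ be a compact parameter space and $\beta_0\in W$. Let $X=(X_t)_{t\in\mathbb{R}}$ be a stationary supOU process with finite second moments whose mean reversion distribution $\pi$ is the law of $BR$ with $R\sim\Gamma(\alpha_\pi,1)$ and whose true parameter vector is $\beta_0$. Let $m\ge2$ be a fixed integer, $X_t^{(m)}=(X_t,\dots,X_{t+m})$, and for $\beta=(\mu,\sigma^2,\alpha_\pi,B)\in W$ let $$f_X(X_t^{(m)},\beta)=\big(f_{\mathbb{E}}(X_t^{(m)},\beta),\,f_{\mathrm{var}}(X_t^{(m)},\beta),\,f_1(X_t^{(m)},\beta),\dots,f_m(X_t^{(m)},\beta)\big)',$$ where $$f_{\mathbb{E}}(X_t^{(m)},\beta)=X_t+\frac{\mu}{B(\alpha_\pi-1)},$$ $$f_{\mathrm{var}}(X_t^{(m)},\beta)=X_t^2-\Big(\frac{\mu}{B(\alpha_\pi-1)}\Big)^2+\frac{\sigma^2}{2B(\alpha_\pi-1)},$$ $$f_h(X_t^{(m)},\beta)=X_tX_{t+h}-\Big(\frac{\mu}{B(\alpha_\pi-1)}\Big)^2+\frac{\sigma^2(1-Bh)^{1-\alpha_\pi}}{2B(\alpha_\pi-1)},\quad h=1,\dots,m.$$ Then the parameter vector $\beta_0$ is identifiable, i.e. for $\beta\in W$: $\mathbb{E}[f_X(X_t^{(m)},\beta)]=0$ if and only if $\beta=\beta_0$.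
   Context: Lévy basis: a real-valued Lévy basis on $\mathbb{R}_-\times\mathbb{R}$ ($\mathbb{R}_-$ = negative reals) is a family $\Lambda=\{\Lambda(C)\}$ of real random variables indexed by bounded Borel sets $C\subset\mathbb{R}_-\times\mathbb{R}$, such that each $\Lambda(C)$ is infinitely divisible, the values on pairwise disjoint sets are independent, and $\Lambda$ is a.s. countably additive on pairwise disjoint sets whose union is bounded. It has generating quadruple $(\gamma,\Sigma,\nu,\pi)$ if $\mathbb{E}(e^{iu\Lambda(C)})=\exp(\phi(u)\Pi(C))$ with $\Pi=\pi\times\lambda$ ($\pi$ a probability measure on $\mathbb{R}_-$, $\lambda$ Lebesgue measure on $\mathbb{R}$) and $\phi(u)=iu\gamma-\tfrac12\Sigma u^2+\int_{\mathbb{R}}(e^{iux}-1-iux1_{\{|x|\le1\}})\nu(dx)$. The underlying Lévy process is $L_t=\Lambda(\mathbb{R}_-\times(0,t])$, $t\ge0$, with $\mu=\mathbb{E}[L_1]$, $\sigma^2=\operatorname{var}(L_1)$. supOU process: $X_t=\int_{\mathbb{R}_-}\int_{-\infty}^t e^{A(t-s)}\Lambda(dA,ds)$, which is well defined and stationary when $\int_{|x|>1}\log|x|\,\nu(dx)<\infty$ and $-\int_{\mathbb{R}_-}\frac1A\pi(dA)<\infty$. If $\int_{|x|>1}x^2\nu(dx)<\infty$, it has finite second moments, and it is known that $\mathbb{E}(X_0)=-\mu\int_{\mathbb{R}_-}\frac1A\pi(dA)$ and $\operatorname{cov}(X_h,X_0)=-\sigma^2\int_{\mathbb{R}_-}\frac{e^{Ah}}{2A}\pi(dA)$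 for $h\ge0$; for $\pi$ the law of $BR$, $B<0$, $R\sim\Gamma(\alpha_\pi,1)$, $\alpha_\pi>1$, these equal $-\frac{\mu}{B(\alpha_\pi-1)}$ and $-\frac{\sigma^2(1-Bh)^{1-\alpha_\pi}}{2B(\alpha_\pi-1)}$. "True parameter vector $\beta_0$" means that the process $X$ is generated with $(\mu,\sigma^2,\alpha_\pi,B)=\beta_0$. *)

theory Defs
  imports "HOL-Probability.Probability"
begin

section \<open>Levy bases on the product of the negative reals with the reals\<close>

abbreviation half_plane :: "(real \<times> real) set" where
  "half_plane \<equiv> {..<0} \<times> UNIV"

definition bounded_borel :: "(real \<times> real) set set" where
  "bounded_borel = {C \<in> sets borel. bounded C \<and> C \<subseteq> half_plane}"

text \<open>For every \<open>n \<ge> 1\<close> the law is that of a sum of \<open>n\<close> independent identically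
  distributed real random variables.\<close>

definition infinitely_divisible :: "real measure \<Rightarrow> bool" where
  "infinitely_divisible N \<longleftrightarrow>
     (\<forall>n\<ge>1. \<exists>Q. real_distribution Q \<and>
        N = distr (\<Pi>\<^sub>M i\<in>{..<n::nat}. Q) borel (\<lambda>x. \<Sum>i<n. x i))"

text \<open>The values of \<open>\<Lambda>\<close> outside \<^const>\<open>bounded_borel\<close> are irrelevant. In the
  independence clause \<open>\<Lambda> {}\<close> may occur repeatedly; it vanishes almost surely by additivity.\<close>

definition levy_basis :: "'a measure \<Rightarrow> ((real \<times> real) set \<Rightarrow> 'a \<Rightarrow> real) \<Rightarrow> bool" where
  "levy_basis M \<Lambda> \<longleftrightarrow>
     prob_space M \<and>
     (\<forall>C\<in>bounded_borel. \<Lambda> C \<in> borel_measurable M \<and> infinitely_divisible (distr M borel (\<Lambda> C))) \<and>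
     (\<forall>C :: nat \<Rightarrow> (real \<times> real) set. range C \<subseteq> bounded_borel \<and> disjoint_family C \<longrightarrow>
        prob_space.indep_vars M (\<lambda>_. borel) (\<lambda>i. \<Lambda> (C i)) UNIV) \<and>
     (\<forall>C :: nat \<Rightarrow> (real \<times> real) set. range C \<subseteq> bounded_borel \<and> disjoint_family C \<and> bounded (\<Union>i. C i) \<longrightarrow>
        (AE \<omega> in M. (\<lambda>i. \<Lambda> (C i) \<omega>) sums \<Lambda> (\<Union>i. C i) \<omega>))"

definition levy_measure :: "real measure \<Rightarrow> bool" where
  "levy_measure \<nu> \<longleftrightarrow>
     sets \<nu> = sets borel \<and> emeasure \<nu> {0} = 0 \<and> integrable \<nu> (\<lambda>x. min 1 (x\<^sup>2))"

definition levy_exponent :: "real \<Rightarrow> real \<Rightarrow> real measure \<Rightarrow> real \<Rightarrow> complex" where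
  "levy_exponent \<gamma> \<Sigma> \<nu> u =
     \<i> * of_real (u * \<gamma>) - of_real (\<Sigma> * u\<^sup>2 / 2) +
     (CLINT x|\<nu>. iexp (u * x) - 1 - \<i> * of_real (u * x) * indicator {x. \<bar>x\<bar> \<le> 1} x)"

text \<open>A probability measure on the negative reals is represented as a Borel probability measure
  on the reals that is concentrated on the negative half-line.\<close>

definition has_generating_quadruple ::
    "'a measure \<Rightarrow> ((real \<times> real) set \<Rightarrow> 'a \<Rightarrow> real) \<Rightarrow>
     real \<Rightarrow> real \<Rightarrow> real measure \<Rightarrow> real measure \<Rightarrow> bool" where
  "has_generating_quadruple M \<Lambda> \<gamma> \<Sigma> \<nu> \<pi> \<longleftrightarrow>
     0 \<le> \<Sigma> \<and> levy_measure \<nu> \<and>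
     real_distribution \<pi> \<and> (AE A in \<pi>. A < 0) \<and>
     (\<forall>C\<in>bounded_borel. \<forall>u.
        char (distr M borel (\<Lambda> C)) u =
        exp (levy_exponent \<gamma> \<Sigma> \<nu> u * of_real (measure (\<pi> \<Otimes>\<^sub>M lborel) C)))"


section \<open>Integration with respect to a Levy basis\<close>

text \<open>The integral of Rajput and Rosinski: a limit in probability of integrals of simple
  functions that converge almost everywhere to the integrand, where the integrals of the simple
  functions over every Borel set are required to converge in probability.\<close>

definition levy_simple :: "(real \<times> real \<Rightarrow> real) \<Rightarrow> bool" where
  "levy_simple g \<longleftrightarrow> finite (range g) \<and> (\<forall>y. y \<noteq> 0 \<longrightarrow> g -` {y} \<in> bounded_borel)"

definition simple_levy_integral ::
    "((real \<times> real) set \<Rightarrow> 'a \<Rightarrow> real) \<Rightarrow> (real \<times> real) set \<Rightarrow> (real \<times> real \<Rightarrow> real) \<Rightarrow> 'a \<Rightarrow> real" where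
  "simple_levy_integral \<Lambda> D g \<omega> = (\<Sum>y\<in>range g - {0}. y * \<Lambda> (g -` {y} \<inter> D) \<omega>)"

definition tendsto_in_prob :: "'a measure \<Rightarrow> (nat \<Rightarrow> 'a \<Rightarrow> real) \<Rightarrow> ('a \<Rightarrow> real) \<Rightarrow> bool" where
  "tendsto_in_prob M Y Z \<longleftrightarrow>
     (\<forall>\<epsilon>>0. (\<lambda>n. measure M {\<omega> \<in> space M. \<epsilon> < \<bar>Y n \<omega> - Z \<omega>\<bar>}) \<longlonglongrightarrow> 0)"

text \<open>\<open>has_levy_integral M \<Lambda> \<pi> f Y\<close> says that \<open>f\<close> is integrable and that \<open>Y\<close> is a version
  of its integral over the half-plane. Null sets are those of the product of \<open>\<pi>\<close> with
  Lebesgue measure, which has the same null sets as the control measure of a non-zero Levy basis.\<close>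

definition has_levy_integral ::
    "'a measure \<Rightarrow> ((real \<times> real) set \<Rightarrow> 'a \<Rightarrow> real) \<Rightarrow> real measure \<Rightarrow>
     (real \<times> real \<Rightarrow> real) \<Rightarrow> ('a \<Rightarrow> real) \<Rightarrow> bool" where
  "has_levy_integral M \<Lambda> \<pi> f Y \<longleftrightarrow>
     f \<in> borel_measurable borel \<and> Y \<in> borel_measurable M \<and>
     (\<exists>g. (\<forall>n. levy_simple (g n)) \<and>
          (AE p in \<pi> \<Otimes>\<^sub>M lborel. (\<lambda>n. g n p) \<longlonglongrightarrow> f p) \<and>
          (\<forall>D\<in>sets borel. \<exists>Z\<in>borel_measurable M.
             tendsto_in_prob M (\<lambda>n. simple_levy_integral \<Lambda> D (g n)) Z) \<and>
          tendsto_in_prob M (\<lambda>n. simple_levy_integral \<Lambda> half_plane (g n)) Y)"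

text \<open>The sets \<open>{..<0} \<times> {0<..t}\<close> are unbounded, so the value of the Levy basis on them is
  the integral of their indicator functions.\<close>

definition underlying_levy_process ::
    "'a measure \<Rightarrow> ((real \<times> real) set \<Rightarrow> 'a \<Rightarrow> real) \<Rightarrow> real measure \<Rightarrow> (real \<Rightarrow> 'a \<Rightarrow> real) \<Rightarrow> bool" where
  "underlying_levy_process M \<Lambda> \<pi> L \<longleftrightarrow>
     (\<forall>t\<ge>0. has_levy_integral M \<Lambda> \<pi> (indicator ({..<0} \<times> {0<..t})) (L t))"


section \<open>supOU processes\<close>

definition supOU_kernel :: "real \<Rightarrow> real \<times> real \<Rightarrow> real" where
  "supOU_kernel t = (\<lambda>(A, s). if A < 0 \<and> s \<le> t then exp (A * (t - s)) else 0)"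

definition supOU_process ::
    "'a measure \<Rightarrow> ((real \<times> real) set \<Rightarrow> 'a \<Rightarrow> real) \<Rightarrow>
     real \<Rightarrow> real \<Rightarrow> real measure \<Rightarrow> real measure \<Rightarrow> (real \<Rightarrow> 'a \<Rightarrow> real) \<Rightarrow> bool" where
  "supOU_process M \<Lambda> \<gamma> \<Sigma> \<nu> \<pi> X \<longleftrightarrow>
     levy_basis M \<Lambda> \<and> has_generating_quadruple M \<Lambda> \<gamma> \<Sigma> \<nu> \<pi> \<and>
     set_integrable \<nu> {x. 1 < \<bar>x\<bar>} (\<lambda>x. ln \<bar>x\<bar>) \<and>
     integrable \<pi> (\<lambda>A. 1 / A) \<and>
     (\<forall>t. has_levy_integral M \<Lambda> \<pi> (supOU_kernel t) (X t))"

definition stationary_process :: "'a measure \<Rightarrow> (real \<Rightarrow> 'a \<Rightarrow> real) \<Rightarrow> bool" where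
  "stationary_process M X \<longleftrightarrow>
     (\<forall>t. X t \<in> borel_measurable M) \<and>
     (\<forall>J h. finite J \<longrightarrow>
        distr M (\<Pi>\<^sub>M t\<in>J. borel) (\<lambda>\<omega>. \<lambda>t\<in>J. X (t + h) \<omega>) =
        distr M (\<Pi>\<^sub>M t\<in>J. borel) (\<lambda>\<omega>. \<lambda>t\<in>J. X t \<omega>))"

definition gamma_density :: "real \<Rightarrow> real \<Rightarrow> real" where
  "gamma_density \<alpha> x = (if 0 < x then x powr (\<alpha> - 1) * exp (- x) / Gamma \<alpha> else 0)"

text \<open>The law of \<open>B R\<close> with \<open>R\<close> Gamma distributed with shape \<open>\<alpha>\<close> and rate one.\<close>

definition mean_reversion_law :: "real \<Rightarrow> real \<Rightarrow> real measure" where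
  "mean_reversion_law \<alpha> B = distr (density lborel (\<lambda>x. ennreal (gamma_density \<alpha> x))) borel (\<lambda>r. B * r)"

text \<open>Parameter vectors are tuples \<open>(\<mu>, \<sigma>\<^sup>2, \<alpha>, B)\<close>; the second component, written \<open>v\<close>,
  is the variance itself.\<close>

type_synonym params = "real \<times> real \<times> real \<times> real"

definition true_params :: "'a measure \<Rightarrow> real measure \<Rightarrow> (real \<Rightarrow> 'a \<Rightarrow> real) \<Rightarrow> params \<Rightarrow> bool" where
  "true_params M \<pi> L = (\<lambda>(\<mu>, v, \<alpha>, B).
     integrable M (\<lambda>\<omega>. (L 1 \<omega>)\<^sup>2) \<and>
     prob_space.expectation M (L 1) = \<mu> \<and>
     prob_space.variance M (L 1) = v \<and>
     \<pi> = mean_reversion_law \<alpha> B)"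


section \<open>Moment function\<close>

text \<open>The argument \<open>x\<close> is the list \<open>[X t, \<dots>, X (t + m)]\<close>.\<close>

definition window :: "(real \<Rightarrow> 'a \<Rightarrow> real) \<Rightarrow> nat \<Rightarrow> real \<Rightarrow> 'a \<Rightarrow> real list" where
  "window X m t \<omega> = map (\<lambda>j. X (t + real j) \<omega>) [0..<m + 1]"

definition f_E :: "real list \<Rightarrow> params \<Rightarrow> real" where
  "f_E x = (\<lambda>(\<mu>, v, \<alpha>, B). x ! 0 + \<mu> / (B * (\<alpha> - 1)))"

definition f_var :: "real list \<Rightarrow> params \<Rightarrow> real" where
  "f_var x = (\<lambda>(\<mu>, v, \<alpha>, B).
     (x ! 0)\<^sup>2 - (\<mu> / (B * (\<alpha> - 1)))\<^sup>2 + v / (2 * B * (\<alpha> - 1)))"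

definition f_lag :: "nat \<Rightarrow> real list \<Rightarrow> params \<Rightarrow> real" where
  "f_lag h x = (\<lambda>(\<mu>, v, \<alpha>, B).
     x ! 0 * x ! h - (\<mu> / (B * (\<alpha> - 1)))\<^sup>2 +
     v * (1 - B * real h) powr (1 - \<alpha>) / (2 * B * (\<alpha> - 1)))"

definition f_X :: "nat \<Rightarrow> real list \<Rightarrow> params \<Rightarrow> real list" where
  "f_X m x \<beta> = f_E x \<beta> # f_var x \<beta> # map (\<lambda>h. f_lag h x \<beta>) [1..<m + 1]"

end

theory Submission
  imports Defs
begin

text \<open>The moment conditions determine \<open>\<beta>\<close> because \<open>ln (1 + 2 b) / ln (1 + b)\<close> is strictly decreasing
  in \<open>b > 0\<close>: lags \<open>1\<close> and \<open>2\<close> of the normalised autocovariance give \<open>B\<close>, hence \<open>\<alpha>\<close>, and then mean and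
  variance give the rest. The moments of \<open>X\<close> come from the formula
  \<open>E exp (i u \<integral>f d\<Lambda>) = exp (\<integral>\<psi> (u f) d\<rho>)\<close>, where \<open>\<psi>\<close> is the Levy exponent and \<open>\<rho>\<close> the product of \<open>\<pi>\<close>
  with Lebesgue measure: applied to \<open>L 1\<close> it yields the second order
  expansion of \<open>\<psi>\<close> at \<open>0\<close> in terms of the mean and variance of \<open>L 1\<close>, and applied to the supOU kernels and
  their pairwise sums it turns this expansion into first and second moments.

  For the formula, let \<open>g n\<close> be the simple functions defining the integral. By a Vitali-Hahn-Saks argument,
  convergence of \<open>\<integral>\<^sub>D g n d\<Lambda>\<close> in probability for every \<open>D\<close> makes these integrals small on small sets \<open>D\<close>,
  uniformly in \<open>n\<close>. One may therefore discard the complement of a large ball and the set where \<open>g n\<close> is not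
  yet close to \<open>f\<close>, and pass to the limit by dominated convergence.\<close>

section \<open>The theorem of Vitali, Hahn and Saks\<close>

text \<open>The obstacle is that the defining sequence \<open>g n\<close> carries no bound: it
  converges almost everywhere and its integrals converge in probability, but neither fact dominates
  \<open>\<psi> (u * g n p)\<close>. The missing uniformity can only come from the demand that the
  integrals converge over every Borel set \<open>D\<close>, and Baire's theorem turns this pointwise
  statement about sets into a uniform one. On the part that is kept, \<open>g n\<close> differs from
  the bounded kernel \<open>f\<close> by at most one and the control measure is finite, so
  continuity of \<open>\<psi>\<close> provides a constant majorant. Moments are given for
  \<open>L 1\<close> and not for the Levy measure. The expansion of \<open>\<psi>\<close> is
  therefore extracted from a characteristic function, by inverting the exponential near
  \<open>0\<close>, and not by differentiating the Levy-Khintchine formula under the integral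
  sign.\<close>

text \<open>Baire's theorem for the measurable sets with the measure of the symmetric difference as distance.
  Completeness is seen through the limes superior of a fast Cauchy sequence.\<close>

lemma (in finite_measure) measure_algebra_Baire:
  fixes Q :: "nat \<Rightarrow> 'a set \<Rightarrow> bool"
  assumes cover: "\<And>D. D \<in> sets M \<Longrightarrow> \<exists>n. Q n D"
    and closed: "\<And>n D. D \<in> sets M \<Longrightarrow> \<not> Q n D \<Longrightarrow>
      \<exists>r>0. \<forall>D'\<in>sets M. measure M (sym_diff D D') < r \<longrightarrow> \<not> Q n D'"
  obtains n E r where "E \<in> sets M" "0 < r"
    "\<And>D. D \<in> sets M \<Longrightarrow> measure M (sym_diff E D) < r \<Longrightarrow> Q n D"
proof (rule ccontr)
  note witness = that
  assume no: "\<not> thesis"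
  have dense: "\<exists>D\<in>sets M. measure M (sym_diff E D) < r \<and> \<not> Q n D"
    if "E \<in> sets M" "0 < r" for n E r
    using no witness[OF that] by blast
  \<comment> \<open>A pair is a ball, given by centre and radius. With the ratios 1/4 and 1/2 in
    \<open>step\<close>, all moves after the \<open>n\<close>-th centre add up to at most half the
    \<open>n\<close>-th radius, so the limit lies in every ball.\<close>
  define good where "good = (\<lambda>n (p :: 'a set \<times> real). fst p \<in> sets M \<and> 0 < snd p \<and>
    (\<forall>D\<in>sets M. measure M (sym_diff (fst p) D) < snd p \<longrightarrow> \<not> Q n D))"
  define step where "step = (\<lambda>p q :: 'a set \<times> real. measure M (sym_diff (fst p) (fst q)) < snd p / 4 \<and> snd q \<le> snd p / 2)"
  have extend: "\<exists>q. good n q \<and> step p q" if p: "fst p \<in> sets M" "0 < snd p" for n p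
  proof -
    obtain D where D: "D \<in> sets M" "measure M (sym_diff (fst p) D) < snd p / 4" "\<not> Q n D"
      using dense[OF p(1), of "snd p / 4" n] p(2) by auto
    obtain r where r: "r > 0" "\<forall>D'\<in>sets M. measure M (sym_diff D D') < r \<longrightarrow> \<not> Q n D'"
      using closed[OF D(1,3)] by auto
    have "good n (D, min r (snd p / 2)) \<and> step p (D, min r (snd p / 2))"
      using D r p by (auto simp: good_def step_def)
    then show ?thesis by blast
  qed
  obtain p0 where "good 0 p0"
    using extend[of "({}, 1)" 0] by auto
  have "\<exists>p. \<forall>n. good n (p n) \<and> step (p n) (p (Suc n))"
  proof (rule dependent_nat_choice)
    show "\<exists>p. good 0 p" using \<open>good 0 p0\<close> by blast
    show "\<exists>q. good (Suc n) q \<and> step p q" if "good n p" for p n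
      using extend[of p "Suc n"] that by (auto simp: good_def)
  qed
  then obtain p where p: "\<And>n. good n (p n)" "\<And>n. step (p n) (p (Suc n))"
    by blast
  define F where "F n = fst (p n)" for n
  define r where "r n = snd (p n)" for n
  have F [measurable]: "F n \<in> sets M" and r0: "0 < r n"
    and avoid: "\<And>D. D \<in> sets M \<Longrightarrow> measure M (sym_diff (F n) D) < r n \<Longrightarrow> \<not> Q n D" for n
    using p(1)[of n] by (auto simp: good_def F_def r_def)
  have F_step: "measure M (sym_diff (F n) (F (Suc n))) < r n / 4" and r_step: "r (Suc n) \<le> r n / 2" for n
    using p(2)[of n] by (auto simp: step_def F_def r_def)
  have r_le: "r (n + k) \<le> r n * (1/2) ^ k" for n k
  proof (induction k)
    case (Suc k)
    then show ?case using r_step[of "n + k"] by simp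
  qed simp
  define E where "E = (\<Inter>n. \<Union>k. F (n + k))"
  have E [measurable]: "E \<in> sets M" unfolding E_def by measurable
  have "measure M (sym_diff (F n) E) < r n" for n
  proof -
    define G where "G k = sym_diff (F (n + k)) (F (Suc (n + k)))" for k
    have G [measurable]: "G k \<in> sets M" for k unfolding G_def by measurable
    have G_le: "measure M (G k) \<le> r n / 4 * (1/2) ^ k" for k
      using F_step[of "n + k"] r_le[of n k] by (simp add: G_def)
    have sums: "(\<lambda>k. r n / 4 * (1/2) ^ k) sums (r n / 4 * (1 / (1 - 1/2)))"
      by (intro sums_mult geometric_sums) auto
    have summable: "summable (\<lambda>k. measure M (G k))"
      by (rule summable_comparison_test[OF _ sums_summable[OF sums]]) (use G_le in auto)
    \<comment> \<open>A point in none of the differences of consecutive centres belongs to all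
      \<open>F (n + k)\<close> or to none, so for it membership in the limes superior agrees with
      membership in \<open>F n\<close>.\<close>
    have "sym_diff (F n) E \<subseteq> (\<Union>k. G k)"
    proof
      fix x assume x: "x \<in> sym_diff (F n) E"
      show "x \<in> (\<Union>k. G k)"
      proof (rule ccontr)
        assume no: "x \<notin> (\<Union>k. G k)"
        have const: "x \<in> F (n + k) \<longleftrightarrow> x \<in> F n" for k
        proof (induction k)
          case (Suc k)
          have "x \<notin> G k" using no by blast
          with Suc show ?case by (auto simp: G_def)
        qed simp
        have "x \<in> E \<longleftrightarrow> x \<in> F n"
        proof
          assume "x \<in> E"
          then obtain k where "x \<in> F (n + k)" unfolding E_def by blast
          then show "x \<in> F n" using const by blast
        next
          assume *: "x \<in> F n"
          have "\<exists>k. x \<in> F (j + k)" for j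
            using const[of j] * by (intro exI[of _ n]) (simp add: add.commute)
          then show "x \<in> E" unfolding E_def by blast
        qed
        with x show False by blast
      qed
    qed
    then have "measure M (sym_diff (F n) E) \<le> measure M (\<Union>k. G k)"
      by (intro finite_measure_mono) auto
    also have "\<dots> \<le> (\<Sum>k. measure M (G k))"
      by (intro finite_measure_subadditive_countably summable) auto
    also have "\<dots> \<le> (\<Sum>k. r n / 4 * (1/2) ^ k)"
      by (intro suminf_le G_le summable sums_summable[OF sums])
    also have "\<dots> = r n / 2"
      using sums_unique[OF sums] by simp
    finally show ?thesis using r0[of n] by simp
  qed
  then show False using avoid[OF E] cover[OF E] by blast
qed

text \<open>Here \<open>nrm n D\<close> and \<open>dst n k D\<close> stand for the sizes of \<open>m n D\<close> and \<open>m n D - m k D\<close>, where \<open>m n\<close> is a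
  sequence of finitely additive set functions with values in a space with a translation invariant metric.\<close>

lemma (in finite_measure) Vitali_Hahn_Saks:
  fixes nrm :: "nat \<Rightarrow> 'a set \<Rightarrow> real" and dst :: "nat \<Rightarrow> nat \<Rightarrow> 'a set \<Rightarrow> real"
  assumes cont: "\<And>n e. 0 < e \<Longrightarrow> \<exists>d>0. \<forall>D\<in>sets M. measure M D < d \<longrightarrow> nrm n D \<le> e"
    and Cauchy: "\<And>D e. D \<in> sets M \<Longrightarrow> 0 < e \<Longrightarrow> \<exists>N. \<forall>n\<ge>N. \<forall>k\<ge>N. dst n k D \<le> e"
    and dst_Un: "\<And>n k D E. D \<in> sets M \<Longrightarrow> E \<in> sets M \<Longrightarrow> D \<inter> E = {} \<Longrightarrow>
      dst n k (D \<union> E) \<le> dst n k D + dst n k E"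
    and dst_left: "\<And>n k D E. D \<in> sets M \<Longrightarrow> E \<in> sets M \<Longrightarrow> D \<inter> E = {} \<Longrightarrow>
      dst n k D \<le> dst n k (D \<union> E) + dst n k E"
    and dst_le: "\<And>n k D. D \<in> sets M \<Longrightarrow> dst n k D \<le> nrm n D + nrm k D"
    and nrm_le: "\<And>n k D. D \<in> sets M \<Longrightarrow> nrm n D \<le> dst n k D + nrm k D"
    and "0 < e"
  obtains d N where "0 < d" "\<And>n D. N \<le> n \<Longrightarrow> D \<in> sets M \<Longrightarrow> measure M D < d \<Longrightarrow> nrm n D \<le> e"
proof -
  \<comment> \<open>A Cauchy condition from index \<open>N\<close> on. Of the three thirds of
    \<open>e\<close>, two are spent on sets near the centre \<open>E\<close> and one on the single
    set function with index \<open>N\<close>.\<close>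
  define Q where "Q N D \<longleftrightarrow> (\<forall>n\<ge>N. \<forall>k\<ge>N. dst n k D \<le> e / 3)" for N D
  obtain N E r where E: "E \<in> sets M" and r: "0 < r"
    and ball: "\<And>D. D \<in> sets M \<Longrightarrow> measure M (sym_diff E D) < r \<Longrightarrow> Q N D"
  proof (rule measure_algebra_Baire[of Q])
    show "\<exists>N. Q N D" if "D \<in> sets M" for D
      using Cauchy[OF that, of "e / 3"] \<open>0 < e\<close> by (auto simp: Q_def)
    show "\<exists>r>0. \<forall>D'\<in>sets M. measure M (sym_diff D D') < r \<longrightarrow> \<not> Q N D'"
      if D: "D \<in> sets M" "\<not> Q N D" for N D
    proof -
      obtain n k where nk: "n \<ge> N" "k \<ge> N" "dst n k D > e / 3"
        using D(2) by (auto simp: Q_def not_le)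
      \<comment> \<open>Passing from \<open>D\<close> to \<open>D'\<close> discards and adds one
        small set, each of size at most \<open>2 * t\<close>. A fifth of the excess over
        \<open>e / 3\<close> therefore leaves \<open>t\<close> to spare.\<close>
      define t where "t = (dst n k D - e / 3) / 5"
      have t: "0 < t" using nk by (simp add: t_def)
      obtain d1 where d1: "d1 > 0" "\<And>D. D \<in> sets M \<Longrightarrow> measure M D < d1 \<Longrightarrow> nrm n D \<le> t"
        using cont[OF t, of n] by blast
      obtain d2 where d2: "d2 > 0" "\<And>D. D \<in> sets M \<Longrightarrow> measure M D < d2 \<Longrightarrow> nrm k D \<le> t"
        using cont[OF t, of k] by blast
      have small: "dst n k A \<le> 2 * t" if "A \<in> sets M" "measure M A < min d1 d2" for A
        using dst_le[OF that(1), of n k] d1(2)[of A] d2(2)[of A] that by auto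
      have "\<not> Q N D'" if D': "D' \<in> sets M" "measure M (sym_diff D D') < min d1 d2" for D'
      proof -
        have m1: "measure M (D - D') < min d1 d2"
          using finite_measure_mono[of "D - D'" "sym_diff D D'"] D D' by auto
        have m2: "measure M (D' - D) < min d1 d2"
          using finite_measure_mono[of "D' - D" "sym_diff D D'"] D D' by auto
        have "dst n k D \<le> dst n k (D \<inter> D') + dst n k (D - D')"
          using dst_Un[of "D \<inter> D'" "D - D'" n k] D D' by (auto simp: Int_Diff_Un)
        moreover have "dst n k (D \<inter> D') \<le> dst n k D' + dst n k (D' - D)"
          using dst_left[of "D \<inter> D'" "D' - D" n k] D D'
          by (auto simp: Int_commute[of D D'] Int_Diff_Un)
        ultimately have "dst n k D \<le> dst n k D' + 4 * t"
          using small[of "D - D'"] small[of "D' - D"] m1 m2 D D' by auto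
        moreover have "5 * t = dst n k D - e / 3" by (simp add: t_def)
        ultimately have "dst n k D' > e / 3" using nk(3) t by linarith
        then show ?thesis using nk by (auto simp: Q_def not_le)
      qed
      then show ?thesis using d1(1) d2(1) by (intro exI[of _ "min d1 d2"]) auto
    qed
  qed blast
  obtain d where d: "d > 0" "\<And>D. D \<in> sets M \<Longrightarrow> measure M D < d \<Longrightarrow> nrm N D \<le> e / 3"
    using cont[of "e / 3" N] \<open>0 < e\<close> by auto
  have "nrm n D \<le> e" if "N \<le> n" and D: "D \<in> sets M" "measure M D < min d r" for n D
  proof -
    \<comment> \<open>Transfer from \<open>E\<close> to the empty set: a small \<open>D\<close> is
      the difference of \<open>E \<union> D\<close> and \<open>E - D\<close>, and both of these are
      close to \<open>E\<close>.\<close>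
    have "Q N (E \<union> D)"
    proof (rule ball)
      show "measure M (sym_diff E (E \<union> D)) < r"
        using finite_measure_mono[of "sym_diff E (E \<union> D)" D] D by fastforce
    qed (use E D in auto)
    moreover have "Q N (E - D)"
    proof (rule ball)
      show "measure M (sym_diff E (E - D)) < r"
        using finite_measure_mono[of "sym_diff E (E - D)" D] D by fastforce
    qed (use E D in auto)
    moreover have "dst n N D \<le> dst n N (D \<union> (E - D)) + dst n N (E - D)"
      using E D by (intro dst_left) auto
    moreover have "D \<union> (E - D) = E \<union> D" by blast
    ultimately have "dst n N D \<le> e / 3 + e / 3"
      using \<open>N \<le> n\<close> unfolding Q_def by fastforce
    moreover have "nrm N D \<le> e / 3" using d(2) D by auto
    ultimately show ?thesis using nrm_le[OF D(1), of n N] by auto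
  qed
  then show thesis using that[of "min d r" N] d(1) r by auto
qed

section \<open>Second order expansion of characteristic functions\<close>

text \<open>The value \<open>1 / 2\<close> fills the removable singularity at \<open>0\<close>. The
  identity \<open>exp_eq_rem\<close> thus holds without exception, and expansions become algebra
  with a remainder factor that is continuous at \<open>0\<close>.\<close>

definition exp_rem :: "complex \<Rightarrow> complex" where
  "exp_rem w = (if w = 0 then 1 / 2 else (exp w - 1 - w) / w\<^sup>2)"

lemma exp_eq_rem: "exp w = 1 + w + w\<^sup>2 * exp_rem w"
  by (simp add: exp_rem_def)

lemma exp_rem_tendsto [tendsto_intros]:
  assumes "(f \<longlongrightarrow> 0) F"
  shows "((\<lambda>x. exp_rem (f x)) \<longlongrightarrow> 1 / 2) F"
proof (rule LIM_zero_cancel, rule tendsto_0_le[where K = 1])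
  have "((\<lambda>x. exp (norm (f x)) * norm (f x)) \<longlongrightarrow> exp (norm (0 :: complex)) * norm (0 :: complex)) F"
    by (intro tendsto_intros assms)
  then show "((\<lambda>x. exp (norm (f x)) * norm (f x)) \<longlongrightarrow> 0) F" by simp
  show "\<forall>\<^sub>F x in F. norm (exp_rem (f x) - 1 / 2) \<le> norm (exp (norm (f x)) * norm (f x)) * 1"
  proof (rule always_eventually, rule allI)
    fix x
    define w where "w = f x"
    have "norm (exp_rem w - 1 / 2) \<le> exp (norm w) * norm w"
    proof (cases "w = 0")
      case False
      have "norm (exp w - (1 + w + w\<^sup>2 / 2)) \<le> exp \<bar>Re w\<bar> * norm w ^ 3 / 2"
        using Taylor_exp[of w 2] by (simp add: numeral_2_eq_2 numeral_3_eq_3)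
      also have "\<dots> \<le> exp (norm w) * norm w ^ 3"
      proof -
        have "exp \<bar>Re w\<bar> * norm w ^ 3 \<le> exp (norm w) * norm w ^ 3"
          using abs_Re_le_cmod[of w] by (intro mult_right_mono) auto
        moreover have "0 \<le> exp (norm w) * norm w ^ 3" by simp
        ultimately show ?thesis by linarith
      qed
      finally have "norm (exp w - (1 + w + w\<^sup>2 / 2)) / (norm w)\<^sup>2 \<le> exp (norm w) * norm w ^ 3 / (norm w)\<^sup>2"
        by (intro divide_right_mono) auto
      also have "exp w - (1 + w + w\<^sup>2 / 2) = w\<^sup>2 * (exp_rem w - 1 / 2)"
        using False by (simp add: exp_rem_def field_simps)
      finally show ?thesis
        using False by (simp add: norm_mult norm_power power2_eq_square power3_eq_cube)
    qed (simp add: exp_rem_def)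
    then show "norm (exp_rem (f x) - 1 / 2) \<le> norm (exp (norm (f x)) * norm (f x)) * 1"
      by (simp add: w_def)
  qed
qed

lemma iexp_second_order_bound: "norm (iexp x - 1 - \<i> * x) \<le> x\<^sup>2 / 2"
  using iexp_approx1[of x 1] by (simp add: algebra_simps numeral_2_eq_2)

text \<open>Divided by the square of \<open>u\<close>, the Taylor remainder of
  \<open>iexp (u * X \<omega>)\<close> is at most \<open>(X \<omega>)\<^sup>2 / 2\<close> for every
  nonzero \<open>u\<close>. This majorant is integrable, so the limit may be taken under the
  expectation.\<close>

lemma (in prob_space) char_second_order:
  fixes X :: "'a \<Rightarrow> real"
  assumes [measurable]: "X \<in> borel_measurable M" and X2: "integrable M (\<lambda>\<omega>. (X \<omega>)\<^sup>2)"
  shows "((\<lambda>u. (char (distr M borel X) u - 1 - \<i> * u * expectation X) / (of_real u)\<^sup>2)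
    \<longlongrightarrow> - complex_of_real (expectation (\<lambda>\<omega>. (X \<omega>)\<^sup>2)) / 2) (at 0)"
proof -
  have X1: "integrable M X"
    using square_integrable_imp_integrable[OF _ X2] by simp
  have int: "integrable M (\<lambda>\<omega>. iexp (u * X \<omega>))" for u
    by (rule integrable_const_bound[where B = 1]) auto
  have eq: "(char (distr M borel X) u - 1 - \<i> * u * expectation X) / (of_real u)\<^sup>2 =
      (CLINT \<omega>|M. (iexp (u * X \<omega>) - 1 - \<i> * of_real (u * X \<omega>)) / (of_real u)\<^sup>2)" for u
  proof -
    have "(CLINT \<omega>|M. (iexp (u * X \<omega>) - 1 - \<i> * of_real (u * X \<omega>)))
      = (CLINT \<omega>|M. iexp (u * X \<omega>)) - 1 - \<i> * u * expectation X"
      using int[of u] X1 by (simp add: prob_space integral_complex_of_real mult.assoc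
        Bochner_Integration.integral_diff)
    then show ?thesis by (simp add: char_def integral_distr)
  qed
  show ?thesis
    unfolding eq tendsto_at_iff_sequentially
  proof (intro allI impI)
    fix v :: "nat \<Rightarrow> real" assume v: "\<forall>i. v i \<in> UNIV - {0}" "v \<longlonglongrightarrow> 0"
    have "(\<lambda>i. CLINT \<omega>|M. (iexp (v i * X \<omega>) - 1 - \<i> * of_real (v i * X \<omega>)) / (of_real (v i))\<^sup>2)
      \<longlonglongrightarrow> (CLINT \<omega>|M. of_real (- (X \<omega>)\<^sup>2 / 2))"
    proof (rule integral_dominated_convergence[where w = "\<lambda>\<omega>. (X \<omega>)\<^sup>2 / 2"])
      show "AE \<omega> in M. (\<lambda>i. (iexp (v i * X \<omega>) - 1 - \<i> * of_real (v i * X \<omega>)) / (of_real (v i))\<^sup>2)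
         \<longlonglongrightarrow> of_real (- (X \<omega>)\<^sup>2 / 2)"
      proof (rule AE_I2)
        fix \<omega>
        have "(\<lambda>i. \<i> * of_real (v i * X \<omega>)) \<longlonglongrightarrow> \<i> * of_real (0 * X \<omega>)"
          by (intro tendsto_intros v)
        then have "(\<lambda>i. (\<i> * of_real (X \<omega>))\<^sup>2 * exp_rem (\<i> * of_real (v i * X \<omega>))) \<longlonglongrightarrow> (\<i> * of_real (X \<omega>))\<^sup>2 * (1/2)"
          by (intro tendsto_intros) simp
        moreover have "(iexp (v i * X \<omega>) - 1 - \<i> * of_real (v i * X \<omega>)) / (of_real (v i))\<^sup>2
            = (\<i> * of_real (X \<omega>))\<^sup>2 * exp_rem (\<i> * of_real (v i * X \<omega>))" for i
          using v(1) by (subst exp_eq_rem) (simp add: power2_eq_square field_simps)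
        ultimately show "(\<lambda>i. (iexp (v i * X \<omega>) - 1 - \<i> * of_real (v i * X \<omega>)) / (of_real (v i))\<^sup>2)
         \<longlonglongrightarrow> of_real (- (X \<omega>)\<^sup>2 / 2)"
          by (simp add: power_mult_distrib)
      qed
      show "AE \<omega> in M. norm ((iexp (v i * X \<omega>) - 1 - \<i> * of_real (v i * X \<omega>)) / (of_real (v i))\<^sup>2) \<le> (X \<omega>)\<^sup>2 / 2" for i
      proof (rule AE_I2)
        fix \<omega>
        have "norm (iexp (v i * X \<omega>) - 1 - \<i> * of_real (v i * X \<omega>)) \<le> (v i * X \<omega>)\<^sup>2 / 2"
          by (rule iexp_second_order_bound)
        then show "norm ((iexp (v i * X \<omega>) - 1 - \<i> * of_real (v i * X \<omega>)) / (of_real (v i))\<^sup>2) \<le> (X \<omega>)\<^sup>2 / 2"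
          using v(1) by (simp add: norm_divide norm_power power_mult_distrib field_simps)
      qed
    qed (use X2 in auto)
    moreover have "(CLINT \<omega>|M. of_real (- (X \<omega>)\<^sup>2 / 2)) = - complex_of_real (expectation (\<lambda>\<omega>. (X \<omega>)\<^sup>2)) / 2"
      by (subst integral_complex_of_real) simp
    ultimately show "((\<lambda>u. CLINT \<omega>|M. (iexp (u * X \<omega>) - 1 - \<i> * of_real (u * X \<omega>)) / (of_real u)\<^sup>2) \<circ> v)
      \<longlonglongrightarrow> - complex_of_real (expectation (\<lambda>\<omega>. (X \<omega>)\<^sup>2)) / 2"
      by (simp add: o_def)
  qed
qed

lemma tendsto_first_order:
  fixes f :: "real \<Rightarrow> complex"
  assumes "((\<lambda>u. (f u - \<i> * u * a) / (of_real u)\<^sup>2) \<longlongrightarrow> l) (at 0)"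
  shows "((\<lambda>u. f u / u) \<longlongrightarrow> \<i> * a) (at 0)" "(f \<longlongrightarrow> 0) (at 0)"
proof -
  have "((\<lambda>u. u * ((f u - \<i> * u * a) / (of_real u)\<^sup>2) + \<i> * a) \<longlongrightarrow> of_real 0 * l + \<i> * a) (at 0)"
    by (intro tendsto_intros assms)
  then show *: "((\<lambda>u. f u / u) \<longlongrightarrow> \<i> * a) (at 0)"
    by (rule filterlim_cong[THEN iffD1, rotated -1])
       (auto simp: eventually_at_filter power2_eq_square field_simps intro!: always_eventually)
  have "((\<lambda>u. f u / u * of_real u) \<longlongrightarrow> (\<i> * a) * of_real 0) (at 0)"
    by (intro tendsto_intros *)
  then show "(f \<longlongrightarrow> 0) (at 0)"
    by (rule filterlim_cong[THEN iffD1, rotated -1])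
       (auto simp: eventually_at_filter intro!: always_eventually)
qed

text \<open>No branch of the logarithm is chosen: \<open>w\<close> is given and tends to
  \<open>0\<close>. Hence \<open>exp w - 1 = w * (1 + w * exp_rem w)\<close> can be divided by its
  second factor, which yields the first order of \<open>w\<close>; this in turn determines the
  quadratic correction. The subtracted \<open>a\<^sup>2\<close> turns a second moment into a
  variance.\<close>

lemma log_second_order:
  fixes w :: "real \<Rightarrow> complex" and a c :: real
  assumes w: "(w \<longlongrightarrow> 0) (at 0)"
    and lim: "((\<lambda>u. (exp (w u) - 1 - \<i> * u * a) / (of_real u)\<^sup>2) \<longlongrightarrow> - of_real c / 2) (at 0)"
  shows "((\<lambda>u. (w u - \<i> * u * a) / (of_real u)\<^sup>2) \<longlongrightarrow> - of_real (c - a\<^sup>2) / 2) (at 0)"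
proof -
  have first: "((\<lambda>u. (exp (w u) - 1) / u) \<longlongrightarrow> \<i> * a) (at 0)"
    by (rule tendsto_first_order(1)[OF lim])
  have den: "((\<lambda>u. 1 + w u * exp_rem (w u)) \<longlongrightarrow> 1 + 0 * (1/2)) (at 0)"
    by (intro tendsto_intros w)
  then have ne: "\<forall>\<^sub>F u in at 0. 1 + w u * exp_rem (w u) \<noteq> 0"
    by (intro tendsto_imp_eventually_ne) auto
  have "((\<lambda>u. (exp (w u) - 1) / u / (1 + w u * exp_rem (w u))) \<longlongrightarrow> \<i> * a / (1 + 0 * (1/2))) (at 0)"
    by (intro tendsto_intros first den) simp
  moreover have "\<forall>\<^sub>F u in at 0. (exp (w u) - 1) / u / (1 + w u * exp_rem (w u)) = w u / u"
    using ne
  proof eventually_elim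
    case (elim u)
    have "exp (w u) - 1 = w u * (1 + w u * exp_rem (w u))"
      by (subst exp_eq_rem) (simp add: algebra_simps power2_eq_square)
    with elim show ?case by simp
  qed
  ultimately have w_div: "((\<lambda>u. w u / u) \<longlongrightarrow> \<i> * a) (at 0)"
    using filterlim_cong[OF refl refl] by fastforce
  have "((\<lambda>u. (exp (w u) - 1 - \<i> * u * a) / (of_real u)\<^sup>2 - (w u / u)\<^sup>2 * exp_rem (w u))
      \<longlongrightarrow> - of_real c / 2 - (\<i> * a)\<^sup>2 * (1/2)) (at 0)"
    by (intro tendsto_intros lim w w_div)
  moreover have "(\<lambda>u. (exp (w u) - 1 - \<i> * u * a) / (of_real u)\<^sup>2 - (w u / u)\<^sup>2 * exp_rem (w u)) =
      (\<lambda>u. (w u - \<i> * u * a) / (of_real u)\<^sup>2)"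
    by (rule ext, subst exp_eq_rem) (simp add: power_divide diff_divide_distrib add_divide_distrib)
  ultimately show ?thesis by (simp add: power_mult_distrib diff_divide_distrib)
qed

lemma exp_second_order:
  fixes w :: "real \<Rightarrow> complex" and a b :: real
  assumes lim: "((\<lambda>u. (w u - \<i> * u * a) / (of_real u)\<^sup>2) \<longlongrightarrow> - of_real b / 2) (at 0)"
  shows "((\<lambda>u. (exp (w u) - 1 - \<i> * u * a) / (of_real u)\<^sup>2) \<longlongrightarrow> - of_real (b + a\<^sup>2) / 2) (at 0)"
proof -
  have "((\<lambda>u. (w u - \<i> * u * a) / (of_real u)\<^sup>2 + (w u / u)\<^sup>2 * exp_rem (w u))
      \<longlongrightarrow> - of_real b / 2 + (\<i> * a)\<^sup>2 * (1/2)) (at 0)"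
    by (intro tendsto_intros lim tendsto_first_order[OF lim])
  moreover have "(\<lambda>u. (w u - \<i> * u * a) / (of_real u)\<^sup>2 + (w u / u)\<^sup>2 * exp_rem (w u)) =
      (\<lambda>u. (exp (w u) - 1 - \<i> * u * a) / (of_real u)\<^sup>2)"
    by (rule ext, subst exp_eq_rem[of "w _"]) (simp add: power_divide diff_divide_distrib add_divide_distrib)
  ultimately show ?thesis by (simp add: power_mult_distrib diff_divide_distrib add_divide_distrib)
qed

text \<open>Two expansions of the same characteristic function are compared, one from the moments of
  \<open>X\<close> and one from \<open>w\<close>. Uniqueness of limits identifies the coefficients,
  with \<open>a\<close> as mean and \<open>b\<close> as variance.\<close>

lemma (in prob_space) moments_of_log_char:
  fixes X :: "'a \<Rightarrow> real" and w :: "real \<Rightarrow> complex" and a b :: real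
  assumes X: "X \<in> borel_measurable M" "integrable M (\<lambda>\<omega>. (X \<omega>)\<^sup>2)"
    and char: "\<forall>\<^sub>F u in at 0. char (distr M borel X) u = exp (w u)"
    and lim: "((\<lambda>u. (w u - \<i> * u * a) / (of_real u)\<^sup>2) \<longlongrightarrow> - of_real b / 2) (at 0)"
  shows "expectation X = a" "expectation (\<lambda>\<omega>. (X \<omega>)\<^sup>2) = b + a\<^sup>2"
proof -
  let ?\<phi> = "char (distr M borel X)"
  have 1: "((\<lambda>u. (?\<phi> u - 1 - \<i> * u * expectation X) / (of_real u)\<^sup>2)
    \<longlongrightarrow> - complex_of_real (expectation (\<lambda>\<omega>. (X \<omega>)\<^sup>2)) / 2) (at 0)"
    by (rule char_second_order[OF X])
  have 2: "((\<lambda>u. (?\<phi> u - 1 - \<i> * u * a) / (of_real u)\<^sup>2) \<longlongrightarrow> - of_real (b + a\<^sup>2) / 2) (at 0)"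
    by (rule filterlim_cong[THEN iffD1, OF refl refl _ exp_second_order[OF lim]])
       (use char in eventually_elim, simp)
  have "\<i> * expectation X = \<i> * a"
    by (rule tendsto_unique[OF _ tendsto_first_order(1)[OF 1] tendsto_first_order(1)[OF 2]]) simp
  then show mean: "expectation X = a" by simp
  have "- complex_of_real (expectation (\<lambda>\<omega>. (X \<omega>)\<^sup>2)) / 2 = - of_real (b + a\<^sup>2) / 2"
    by (rule tendsto_unique[OF _ 1[unfolded mean] 2]) simp
  then show "expectation (\<lambda>\<omega>. (X \<omega>)\<^sup>2) = b + a\<^sup>2"
    by (metis divide_cancel_right neg_equal_iff_equal of_real_eq_iff zero_neq_numeral)
qed

section \<open>Gamma integrals\<close>

text \<open>Euler's integral for the Gamma function after the substitution of \<open>k * r\<close>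
  for \<open>r\<close>.\<close>

lemma nn_integral_powr_exp:
  fixes s k :: real
  assumes "0 < s" "0 < k"
  shows "(\<integral>\<^sup>+r. ennreal (indicator {0<..} r * (r powr (s - 1) * exp (- (k * r)))) \<partial>lborel) = ennreal (Gamma s / k powr s)"
proof -
  have "(\<integral>\<^sup>+r. ennreal (indicator {0<..} r * (r powr (s - 1) * exp (- r))) \<partial>lborel) = ennreal (Gamma s)"
    unfolding Gamma_conv_nn_integral_real[OF assms(1)]
    by (intro nn_integral_cong) (auto simp: indicator_def exp_minus field_simps)
  then have "ennreal (Gamma s) = ennreal k * (\<integral>\<^sup>+r. ennreal (indicator {0<..} (k * r) * ((k * r) powr (s - 1) * exp (- (k * r)))) \<partial>lborel)"
    using nn_integral_real_affine[of "\<lambda>r. ennreal (indicator {0<..} r * (r powr (s - 1) * exp (- r)))" k 0] assms by simp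
  also have "\<dots> = ennreal k * (\<integral>\<^sup>+r. ennreal (k powr (s - 1)) * ennreal (indicator {0<..} r * (r powr (s - 1) * exp (- (k * r)))) \<partial>lborel)"
    using assms by (intro arg_cong2[where f = "(*)"] refl nn_integral_cong)
      (auto simp: indicator_def powr_mult zero_less_mult_iff ennreal_mult' mult.assoc)
  also have "\<dots> = ennreal (k powr s) * (\<integral>\<^sup>+r. ennreal (indicator {0<..} r * (r powr (s - 1) * exp (- (k * r)))) \<partial>lborel)"
    using assms by (subst nn_integral_cmult)
      (auto simp: mult.assoc[symmetric] ennreal_mult'[symmetric] powr_diff)
  finally have *: "ennreal (k powr s) * (\<integral>\<^sup>+r. ennreal (indicator {0<..} r * (r powr (s - 1) * exp (- (k * r)))) \<partial>lborel) = ennreal (Gamma s)" ..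
  have "ennreal (Gamma s / k powr s) = ennreal (1 / k powr s) * ennreal (Gamma s)"
    using assms by (simp add: ennreal_mult'[symmetric] Gamma_real_pos less_imp_le)
  also have "\<dots> = (\<integral>\<^sup>+r. ennreal (indicator {0<..} r * (r powr (s - 1) * exp (- (k * r)))) \<partial>lborel)"
    unfolding *[symmetric] mult.assoc[symmetric] using assms by (simp add: ennreal_mult'[symmetric])
  finally show ?thesis ..
qed

text \<open>The parameters cover two cases at once: \<open>c = 1\<close>, \<open>h = 0\<close> is
  the supOU kernel itself, while \<open>c = 2\<close> with lag \<open>h\<close> is the product of
  the kernels at times \<open>t\<close> and \<open>t + h\<close>.\<close>

lemma nn_integral_exp_tail:
  fixes A c h t :: real
  assumes "A < 0" "0 < c"
  shows "(\<integral>\<^sup>+s. ennreal (if s \<le> t then exp (A * (c * (t - s) + h)) else 0) \<partial>lborel) = ennreal (exp (A * h) / (- (c * A)))"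
proof -
  have "(\<integral>\<^sup>+s. ennreal (if s \<le> t then exp (A * (c * (t - s) + h)) else 0) \<partial>lborel) =
    (\<integral>\<^sup>+s. ennreal (exp (A * (c * s + h))) * indicator {0..} s \<partial>lborel)"
    by (subst nn_integral_real_affine[where c = "-1" and t = t])
       (auto intro!: nn_integral_cong simp: indicator_def)
  also have "\<dots> = ennreal (0 - exp (A * (c * 0 + h)) / (c * A))"
  proof (rule nn_integral_FTC_atLeast)
    show "((\<lambda>s. exp (A * (c * s + h)) / (c * A)) has_real_derivative exp (A * (c * s + h))) (at s)" for s
      using assms by (auto intro!: derivative_eq_intros)
    have "filterlim (\<lambda>s. A * c * s) at_bot at_top"
      using assms by (intro filterlim_tendsto_neg_mult_at_bot[OF tendsto_const] mult_neg_pos filterlim_ident)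
    then have "((\<lambda>s. exp (A * c * s) * (exp (A * h) / (c * A))) \<longlongrightarrow> 0 * (exp (A * h) / (c * A))) at_top"
      by (intro tendsto_mult tendsto_const filterlim_compose[OF exp_at_bot])
    then show "((\<lambda>s. exp (A * (c * s + h)) / (c * A)) \<longlongrightarrow> 0) at_top"
      by (simp add: algebra_simps exp_add)
  qed auto
  finally show ?thesis by simp
qed

lemma gamma_density_measurable [measurable]: "gamma_density \<alpha> \<in> borel_measurable borel"
  unfolding gamma_density_def by measurable

text \<open>The factor \<open>1 / A\<close> lowers the Gamma shape from \<open>\<alpha>\<close> to
  \<open>\<alpha> - 1\<close>, still positive, and \<open>exp (A * h)\<close> changes the rate from
  \<open>1\<close> to \<open>1 - B * h\<close>. The functional equation of Gamma then produces the
  denominator \<open>\<alpha> - 1\<close>.\<close>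

lemma nn_integral_mean_reversion_law:
  fixes \<alpha> B c h :: real
  assumes "1 < \<alpha>" "B < 0" "0 < c" "0 \<le> h"
  shows "(\<integral>\<^sup>+A. ennreal (if A < 0 then exp (A * h) / (- (c * A)) else 0) \<partial>mean_reversion_law \<alpha> B) =
    ennreal (- ((1 - B * h) powr (1 - \<alpha>) / (c * B * (\<alpha> - 1))))"
proof -
  have k: "0 < 1 - B * h" using assms by (simp add: mult_nonpos_nonneg le_less_trans[OF _ zero_less_one])
  have G: "Gamma \<alpha> = (\<alpha> - 1) * Gamma (\<alpha> - 1)" "0 < Gamma (\<alpha> - 1)" "0 < Gamma \<alpha>"
    using Gamma_plus1[of "\<alpha> - 1"] Gamma_real_pos[of "\<alpha> - 1"] Gamma_real_pos[of \<alpha>] assms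
    by (auto simp: nonpos_Ints_def)
  have "(\<integral>\<^sup>+A. ennreal (if A < 0 then exp (A * h) / (- (c * A)) else 0) \<partial>mean_reversion_law \<alpha> B) =
    (\<integral>\<^sup>+r. ennreal (gamma_density \<alpha> r) * ennreal (if B * r < 0 then exp (B * r * h) / (- (c * (B * r))) else 0) \<partial>lborel)"
    unfolding mean_reversion_law_def by (simp add: nn_integral_distr nn_integral_density)
  also have "\<dots> = (\<integral>\<^sup>+r. ennreal (1 / (- (c * B) * Gamma \<alpha>)) *
      ennreal (indicator {0<..} r * (r powr (\<alpha> - 1 - 1) * exp (- ((1 - B * h) * r)))) \<partial>lborel)"
  proof (intro nn_integral_cong)
    fix r :: real
    show "ennreal (gamma_density \<alpha> r) * ennreal (if B * r < 0 then exp (B * r * h) / (- (c * (B * r))) else 0) =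
      ennreal (1 / (- (c * B) * Gamma \<alpha>)) *
      ennreal (indicator {0<..} r * (r powr (\<alpha> - 1 - 1) * exp (- ((1 - B * h) * r))))"
    proof (cases "0 < r")
      case True
      have split: "r powr (\<alpha> - 1) = r powr (\<alpha> - 1 - 1) * r"
        using True by (simp add: powr_diff power2_eq_square)
      have join: "exp (- r) * exp (B * r * h) = exp (- ((1 - B * h) * r))"
        by (simp add: exp_add[symmetric] algebra_simps)
      have "0 \<le> 1 / (- (c * B) * Gamma \<alpha>)"
        using assms G by (intro divide_nonneg_pos mult_pos_pos) (auto simp: mult_less_0_iff)
      moreover have "0 \<le> gamma_density \<alpha> r" using G by (simp add: gamma_density_def)
      moreover have "gamma_density \<alpha> r * (if B * r < 0 then exp (B * r * h) / (- (c * (B * r))) else 0) =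
        1 / (- (c * B) * Gamma \<alpha>) * (indicator {0<..} r * (r powr (\<alpha> - 1 - 1) * exp (- ((1 - B * h) * r))))"
      proof -
        have "B * r < 0" using True assms by (simp add: mult_less_0_iff)
        then have "gamma_density \<alpha> r * (if B * r < 0 then exp (B * r * h) / (- (c * (B * r))) else 0) =
          (r powr (\<alpha> - 1)) * (exp (- r) * exp (B * r * h)) / (Gamma \<alpha> * (- (c * (B * r))))"
          using True by (simp add: gamma_density_def)
        also have "\<dots> = (r powr (\<alpha> - 1 - 1) * r) * exp (- ((1 - B * h) * r)) / (Gamma \<alpha> * (- (c * (B * r))))"
          by (simp only: split join)
        also have "\<dots> = 1 / (- (c * B) * Gamma \<alpha>) * (r powr (\<alpha> - 1 - 1) * exp (- ((1 - B * h) * r)))"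
          using True assms G(3) by simp
        finally show ?thesis using True by simp
      qed
      ultimately show ?thesis by (simp only: ennreal_mult'[symmetric])
    qed (use assms in \<open>auto simp: gamma_density_def\<close>)
  qed
  also have "\<dots> = ennreal (1 / (- (c * B) * Gamma \<alpha>)) * ennreal (Gamma (\<alpha> - 1) / (1 - B * h) powr (\<alpha> - 1))"
    using assms k by (subst nn_integral_cmult, measurable, subst nn_integral_powr_exp) auto
  also have "\<dots> = ennreal (1 / (- (c * B) * Gamma \<alpha>) * (Gamma (\<alpha> - 1) / (1 - B * h) powr (\<alpha> - 1)))"
    using assms G by (intro ennreal_mult'[symmetric] divide_nonneg_pos mult_pos_pos) (auto simp: mult_less_0_iff)
  also have "1 / (- (c * B) * Gamma \<alpha>) * (Gamma (\<alpha> - 1) / (1 - B * h) powr (\<alpha> - 1)) =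
      - ((1 - B * h) powr (1 - \<alpha>) / (c * B * (\<alpha> - 1)))"
  proof -
    have "(1 - B * h) powr (1 - \<alpha>) = 1 / (1 - B * h) powr (\<alpha> - 1)"
      using powr_minus_divide[of "1 - B * h" "\<alpha> - 1"] by simp
    moreover have "1 / (- (c * B) * (a * g)) * (g / P) = - (1 / P / (c * B * a))" if "g \<noteq> 0" for a g P :: real
      using that by (simp add: divide_simps)
    ultimately show ?thesis using G(2) unfolding G(1) by simp
  qed
  finally show ?thesis .
qed

lemma sets_mean_reversion_law [simp, measurable_cong]: "sets (mean_reversion_law \<alpha> B) = sets borel"
  by (simp add: mean_reversion_law_def)

text \<open>The integrand is nonnegative, so Tonelli's theorem, integrating over time before the
  mean reversion parameter, delivers integrability together with the value.\<close>

lemma has_bochner_integral_supOU_kernel: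
  fixes \<alpha> B c h t :: real
  assumes "1 < \<alpha>" "B < 0" "0 < c" "0 \<le> h"
  shows "has_bochner_integral (mean_reversion_law \<alpha> B \<Otimes>\<^sub>M lborel)
    (\<lambda>p. if fst p < 0 \<and> snd p \<le> t then exp (fst p * (c * (t - snd p) + h)) else 0)
    (- ((1 - B * h) powr (1 - \<alpha>) / (c * B * (\<alpha> - 1))))"
proof (rule has_bochner_integral_nn_integral)
  let ?f = "\<lambda>p :: real \<times> real. if fst p < 0 \<and> snd p \<le> t then exp (fst p * (c * (t - snd p) + h)) else 0"
  have "?f \<in> borel_measurable (borel \<Otimes>\<^sub>M borel)" by measurable
  also have "borel_measurable (borel \<Otimes>\<^sub>M borel) = borel_measurable (mean_reversion_law \<alpha> B \<Otimes>\<^sub>M lborel)"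
    by (intro measurable_cong_sets sets_pair_measure_cong) auto
  finally show meas: "?f \<in> borel_measurable (mean_reversion_law \<alpha> B \<Otimes>\<^sub>M lborel)" .
  have "(\<integral>\<^sup>+p. ennreal (?f p) \<partial>(mean_reversion_law \<alpha> B \<Otimes>\<^sub>M lborel)) =
      (\<integral>\<^sup>+A. \<integral>\<^sup>+s. ennreal (?f (A, s)) \<partial>lborel \<partial>mean_reversion_law \<alpha> B)"
    using meas by (intro lborel.nn_integral_fst[symmetric]) simp
  also have "\<dots> = (\<integral>\<^sup>+A. ennreal (if A < 0 then exp (A * h) / (- (c * A)) else 0) \<partial>mean_reversion_law \<alpha> B)"
  proof (rule nn_integral_cong)
    fix A
    show "(\<integral>\<^sup>+s. ennreal (?f (A, s)) \<partial>lborel) = ennreal (if A < 0 then exp (A * h) / (- (c * A)) else 0)"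
      using nn_integral_exp_tail[of A c t h] assms(3) by (cases "A < 0") (simp_all cong: if_cong)
  qed
  also have "\<dots> = ennreal (- ((1 - B * h) powr (1 - \<alpha>) / (c * B * (\<alpha> - 1))))"
    by (rule nn_integral_mean_reversion_law[OF assms])
  finally show "(\<integral>\<^sup>+p. ennreal (?f p) \<partial>(mean_reversion_law \<alpha> B \<Otimes>\<^sub>M lborel)) =
      ennreal (- ((1 - B * h) powr (1 - \<alpha>) / (c * B * (\<alpha> - 1))))" .
  show "0 \<le> - ((1 - B * h) powr (1 - \<alpha>) / (c * B * (\<alpha> - 1)))"
    using assms by (auto simp: divide_le_0_iff mult_le_0_iff zero_le_mult_iff mult_less_0_iff)
qed auto

section \<open>Convergence in probability\<close>

text \<open>The distance of \<open>Z\<close> from \<open>0\<close> in a translation invariant metric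
  for convergence in probability. It is subadditive and blind to null sets but not homogeneous, so
  coefficients have to stay inside it.\<close>

definition L0norm :: "'a measure \<Rightarrow> ('a \<Rightarrow> real) \<Rightarrow> real" where
  "L0norm M Z = (\<integral>\<omega>. min 1 \<bar>Z \<omega>\<bar> \<partial>M)"

context prob_space
begin

lemma integrable_min_one [simp]:
  fixes Z :: "'a \<Rightarrow> real"
  shows "Z \<in> borel_measurable M \<Longrightarrow> integrable M (\<lambda>\<omega>. min 1 \<bar>Z \<omega>\<bar>)"
  by (rule integrable_const_bound[where B = 1]) auto

lemma L0norm_cong_AE:
  assumes "Y \<in> borel_measurable M" "Z \<in> borel_measurable M" "AE \<omega> in M. Y \<omega> = Z \<omega>"
  shows "L0norm M Y = L0norm M Z"
  unfolding L0norm_def using assms by (intro integral_cong_AE) auto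

lemma L0norm_triangle:
  assumes "Y \<in> borel_measurable M" "Z \<in> borel_measurable M"
  shows "L0norm M (\<lambda>\<omega>. Y \<omega> + Z \<omega>) \<le> L0norm M Y + L0norm M Z"
proof -
  have "L0norm M (\<lambda>\<omega>. Y \<omega> + Z \<omega>) \<le> (\<integral>\<omega>. min 1 \<bar>Y \<omega>\<bar> + min 1 \<bar>Z \<omega>\<bar> \<partial>M)"
    unfolding L0norm_def
  proof (rule integral_mono)
    show "min 1 \<bar>Y \<omega> + Z \<omega>\<bar> \<le> min 1 \<bar>Y \<omega>\<bar> + min 1 \<bar>Z \<omega>\<bar>" for \<omega>
      by (auto simp: min_def)
  qed (use assms in auto)
  then show ?thesis using assms by (simp add: L0norm_def)
qed

lemma L0norm_uminus: "L0norm M (\<lambda>\<omega>. - Z \<omega>) = L0norm M Z"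
  by (simp add: L0norm_def)

lemma L0norm_triangle_diff:
  assumes "Y \<in> borel_measurable M" "Z \<in> borel_measurable M"
  shows "L0norm M (\<lambda>\<omega>. Y \<omega> - Z \<omega>) \<le> L0norm M Y + L0norm M Z"
  using L0norm_triangle[of Y "\<lambda>\<omega>. - Z \<omega>"] assms by (simp add: L0norm_uminus)

lemma L0norm_sum_le:
  assumes "finite S" "\<And>i. i \<in> S \<Longrightarrow> Y i \<in> borel_measurable M"
  shows "L0norm M (\<lambda>\<omega>. \<Sum>i\<in>S. Y i \<omega>) \<le> (\<Sum>i\<in>S. L0norm M (Y i))"
  using assms
proof (induction S rule: finite_induct)
  case (insert i S)
  then show ?case
    using L0norm_triangle[of "Y i" "\<lambda>\<omega>. \<Sum>i\<in>S. Y i \<omega>"] by (auto intro: order_trans)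
qed (simp add: L0norm_def)

lemma tendsto_in_prob_L0norm:
  assumes [measurable]: "\<And>n. Y n \<in> borel_measurable M" "Z \<in> borel_measurable M"
    and lim: "tendsto_in_prob M Y Z"
  shows "(\<lambda>n. L0norm M (\<lambda>\<omega>. Y n \<omega> - Z \<omega>)) \<longlonglongrightarrow> 0"
proof (rule LIMSEQ_I)
  fix e :: real assume e: "0 < e"
  have "(\<lambda>n. measure M {\<omega> \<in> space M. e / 2 < \<bar>Y n \<omega> - Z \<omega>\<bar>}) \<longlonglongrightarrow> 0"
    using lim[unfolded tendsto_in_prob_def, rule_format, of "e / 2"] e by simp
  then have "\<forall>\<^sub>F n in sequentially. measure M {\<omega> \<in> space M. e / 2 < \<bar>Y n \<omega> - Z \<omega>\<bar>} < e / 2"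
    by (rule order_tendstoD) (use e in auto)
  then obtain N where N: "\<And>n. N \<le> n \<Longrightarrow> measure M {\<omega> \<in> space M. e / 2 < \<bar>Y n \<omega> - Z \<omega>\<bar>} < e / 2"
    by (auto simp: eventually_sequentially)
  have "norm (L0norm M (\<lambda>\<omega>. Y n \<omega> - Z \<omega>) - 0) < e" if "N \<le> n" for n
  proof -
    let ?A = "{\<omega> \<in> space M. e / 2 < \<bar>Y n \<omega> - Z \<omega>\<bar>}"
    have "L0norm M (\<lambda>\<omega>. Y n \<omega> - Z \<omega>) \<le> (\<integral>\<omega>. e / 2 + indicator ?A \<omega> \<partial>M)"
      unfolding L0norm_def
    proof (rule integral_mono)
      show "integrable M (\<lambda>\<omega>. e / 2 + indicator ?A \<omega>)"
        by (intro Bochner_Integration.integrable_add integrable_const integrable_real_indicator)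
           (auto simp: less_top[symmetric])
      show "min 1 \<bar>Y n \<omega> - Z \<omega>\<bar> \<le> e / 2 + indicator ?A \<omega>" if "\<omega> \<in> space M" for \<omega>
        using e that by (auto simp: indicator_def min_def)
    qed auto
    also have "\<dots> = e / 2 + measure M ?A"
      by (subst Bochner_Integration.integral_add) (auto simp: prob_space less_top[symmetric])
    finally show ?thesis
      using N[OF that] by (simp add: L0norm_def)
  qed
  then show "\<exists>no. \<forall>n\<ge>no. norm (L0norm M (\<lambda>\<omega>. Y n \<omega> - Z \<omega>) - 0) < e" by blast
qed

text \<open>The difference of the two exponentials is at most \<open>2\<close> and at most
  \<open>|u|\<close> times the distance of their arguments. The factor \<open>2 + |u|\<close> serves
  both cases of the minimum in \<open>L0norm\<close>.\<close>

lemma char_diff_le_L0norm: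
  assumes [measurable]: "Y \<in> borel_measurable M" "Z \<in> borel_measurable M"
  shows "cmod (char (distr M borel Y) u - char (distr M borel Z) u)
    \<le> (2 + \<bar>u\<bar>) * L0norm M (\<lambda>\<omega>. Y \<omega> - Z \<omega>)"
proof -
  have int: "integrable M (\<lambda>\<omega>. iexp (u * X \<omega>))" if [measurable]: "X \<in> borel_measurable M" for X :: "'a \<Rightarrow> real"
    by (rule integrable_const_bound[where B = 1]) auto
  have pointwise: "cmod (iexp (u * y) - iexp (u * z)) \<le> (2 + \<bar>u\<bar>) * min 1 \<bar>y - z\<bar>" for y z :: real
  proof -
    have "iexp (u * y) - iexp (u * z) = iexp (u * z) * (iexp (u * (y - z)) - 1)"
      by (simp add: exp_add[symmetric] algebra_simps)
    then have eq: "cmod (iexp (u * y) - iexp (u * z)) = cmod (iexp (u * (y - z)) - 1)"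
      by (simp add: norm_mult)
    have 1: "cmod (iexp (u * (y - z)) - 1) \<le> \<bar>u\<bar> * \<bar>y - z\<bar>"
      using iexp_approx1[of "u * (y - z)" 0] by (simp add: abs_mult)
    have 2: "cmod (iexp (u * (y - z)) - 1) \<le> 2"
      using norm_triangle_ineq4[of "iexp (u * (y - z))" 1] by simp
    show ?thesis
    proof (cases "\<bar>y - z\<bar> \<le> 1")
      case True
      have "\<bar>u\<bar> * \<bar>y - z\<bar> \<le> (2 + \<bar>u\<bar>) * \<bar>y - z\<bar>" by (intro mult_right_mono) auto
      with True 1 show ?thesis unfolding eq by (simp add: min_def)
    next
      case False
      with 2 show ?thesis unfolding eq by (simp add: min_def)
    qed
  qed
  have "char (distr M borel Y) u - char (distr M borel Z) u = (CLINT \<omega>|M. iexp (u * Y \<omega>) - iexp (u * Z \<omega>))"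
    using int[of Y] int[of Z] by (simp add: char_def integral_distr Bochner_Integration.integral_diff)
  also have "cmod \<dots> \<le> (\<integral>\<omega>. cmod (iexp (u * Y \<omega>) - iexp (u * Z \<omega>)) \<partial>M)"
    by (rule integral_norm_bound)
  also have "\<dots> \<le> (\<integral>\<omega>. (2 + \<bar>u\<bar>) * min 1 \<bar>Y \<omega> - Z \<omega>\<bar> \<partial>M)"
  proof (rule integral_mono)
    show "integrable M (\<lambda>\<omega>. cmod (iexp (u * Y \<omega>) - iexp (u * Z \<omega>)))"
      by (intro integrable_norm Bochner_Integration.integrable_diff int assms)
    show "integrable M (\<lambda>\<omega>. (2 + \<bar>u\<bar>) * min 1 \<bar>Y \<omega> - Z \<omega>\<bar>)" by auto
  qed (rule pointwise)
  finally show ?thesis by (simp add: L0norm_def)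
qed

text \<open>The sum is allowed to be another version \<open>S n\<close>, because a Levy basis, and
  with it the integral of a simple function, is additive only almost surely.\<close>

lemma tendsto_in_prob_add:
  assumes [measurable]: "\<And>n. Y n \<in> borel_measurable M" "\<And>n. Y' n \<in> borel_measurable M"
      "\<And>n. S n \<in> borel_measurable M" "Z \<in> borel_measurable M" "Z' \<in> borel_measurable M"
    and lim: "tendsto_in_prob M Y Z" "tendsto_in_prob M Y' Z'"
    and S: "\<And>n. AE \<omega> in M. S n \<omega> = Y n \<omega> + Y' n \<omega>"
  shows "tendsto_in_prob M S (\<lambda>\<omega>. Z \<omega> + Z' \<omega>)"
  unfolding tendsto_in_prob_def
proof (intro allI impI)
  fix e :: real assume e: "0 < e"
  have "(\<lambda>n. measure M {\<omega> \<in> space M. e / 2 < \<bar>Y n \<omega> - Z \<omega>\<bar>}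
      + measure M {\<omega> \<in> space M. e / 2 < \<bar>Y' n \<omega> - Z' \<omega>\<bar>}) \<longlonglongrightarrow> 0 + 0"
    using lim[unfolded tendsto_in_prob_def, rule_format, of "e / 2"] e by (intro tendsto_add) simp_all
  then have *: "(\<lambda>n. measure M {\<omega> \<in> space M. e / 2 < \<bar>Y n \<omega> - Z \<omega>\<bar>}
      + measure M {\<omega> \<in> space M. e / 2 < \<bar>Y' n \<omega> - Z' \<omega>\<bar>}) \<longlonglongrightarrow> 0" by simp
  show "(\<lambda>n. measure M {\<omega> \<in> space M. e < \<bar>S n \<omega> - (Z \<omega> + Z' \<omega>)\<bar>}) \<longlonglongrightarrow> 0"
  proof (rule tendsto_sandwich[OF _ _ tendsto_const *]; intro always_eventually allI)
    fix n
    have "measure M {\<omega> \<in> space M. e < \<bar>S n \<omega> - (Z \<omega> + Z' \<omega>)\<bar>}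
      = measure M {\<omega> \<in> space M. e < \<bar>Y n \<omega> + Y' n \<omega> - (Z \<omega> + Z' \<omega>)\<bar>}"
      by (rule finite_measure_eq_AE) (use S[of n] in auto)
    also have "\<dots> \<le> measure M ({\<omega> \<in> space M. e / 2 < \<bar>Y n \<omega> - Z \<omega>\<bar>} \<union> {\<omega> \<in> space M. e / 2 < \<bar>Y' n \<omega> - Z' \<omega>\<bar>})"
    proof (rule finite_measure_mono, rule subsetI)
      fix \<omega> assume "\<omega> \<in> {\<omega> \<in> space M. e < \<bar>Y n \<omega> + Y' n \<omega> - (Z \<omega> + Z' \<omega>)\<bar>}"
      moreover have "e / 2 < \<bar>a\<bar> \<or> e / 2 < \<bar>b\<bar>" if "e < \<bar>a + b\<bar>" for a b :: real
        using that by linarith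
      from this[of "Y n \<omega> - Z \<omega>" "Y' n \<omega> - Z' \<omega>"]
      have "e < \<bar>Y n \<omega> + Y' n \<omega> - (Z \<omega> + Z' \<omega>)\<bar> \<Longrightarrow> e / 2 < \<bar>Y n \<omega> - Z \<omega>\<bar> \<or> e / 2 < \<bar>Y' n \<omega> - Z' \<omega>\<bar>"
        by (simp add: algebra_simps)
      ultimately show "\<omega> \<in> {\<omega> \<in> space M. e / 2 < \<bar>Y n \<omega> - Z \<omega>\<bar>} \<union> {\<omega> \<in> space M. e / 2 < \<bar>Y' n \<omega> - Z' \<omega>\<bar>}"
        by blast
    qed auto
    also have "\<dots> \<le> measure M {\<omega> \<in> space M. e / 2 < \<bar>Y n \<omega> - Z \<omega>\<bar>}
      + measure M {\<omega> \<in> space M. e / 2 < \<bar>Y' n \<omega> - Z' \<omega>\<bar>}"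
      by (rule measure_Un_le) auto
    finally show "measure M {\<omega> \<in> space M. e < \<bar>S n \<omega> - (Z \<omega> + Z' \<omega>)\<bar>} \<le>
      measure M {\<omega> \<in> space M. e / 2 < \<bar>Y n \<omega> - Z \<omega>\<bar>}
      + measure M {\<omega> \<in> space M. e / 2 < \<bar>Y' n \<omega> - Z' \<omega>\<bar>}" .
  qed simp
qed

end

section \<open>Integrals with respect to a Levy basis\<close>

lemma levy_integrand_bound:
  "cmod (iexp (u * x) - 1 - \<i> * of_real (u * x) * indicator {x. \<bar>x\<bar> \<le> 1} x) \<le> (2 + u\<^sup>2) * min 1 (x\<^sup>2)"
proof (cases "\<bar>x\<bar> \<le> 1")
  case True
  then have "x\<^sup>2 \<le> 1" by (simp add: abs_square_le_1)
  have "cmod (iexp (u * x) - 1 - \<i> * of_real (u * x)) \<le> (u * x)\<^sup>2 / 2"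
    by (rule iexp_second_order_bound)
  also have "\<dots> \<le> (2 + u\<^sup>2) * x\<^sup>2" by (simp add: power_mult_distrib algebra_simps)
  finally show ?thesis using True \<open>x\<^sup>2 \<le> 1\<close> by (simp add: min_def)
next
  case False
  then have "1 < x\<^sup>2" by (metis abs_square_le_1 not_le)
  have "cmod (iexp (u * x) - 1) \<le> 2"
    using norm_triangle_ineq4[of "iexp (u * x)" 1] by simp
  also have "\<dots> \<le> 2 + u\<^sup>2" by simp
  finally show ?thesis using False \<open>1 < x\<^sup>2\<close> by (simp add: min_def)
qed

text \<open>A convergent sequence of arguments is bounded by some \<open>K\<close>, and then
  \<open>(2 + K\<^sup>2) * min 1 (x\<^sup>2)\<close> is one integrable majorant for all of
  them.\<close>

lemma continuous_levy_exponent: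
  assumes "levy_measure \<nu>"
  shows "continuous_on UNIV (levy_exponent \<gamma> \<Sigma> \<nu>)"
proof -
  have [measurable_cong]: "sets \<nu> = sets borel" and int: "integrable \<nu> (\<lambda>x. min 1 (x\<^sup>2))"
    using assms by (auto simp: levy_measure_def)
  have "isCont (\<lambda>u. CLINT x|\<nu>. iexp (u * x) - 1 - \<i> * of_real (u * x) * indicator {x. \<bar>x\<bar> \<le> 1} x) u" for u
    unfolding continuous_at_sequentially
  proof safe
    fix v assume v: "v \<longlonglongrightarrow> u"
    obtain K where K: "\<And>n. \<bar>v n\<bar> \<le> K"
      using convergent_imp_Bseq[OF convergentI[OF v]] by (auto simp: Bseq_def)
    show "((\<lambda>u. CLINT x|\<nu>. iexp (u * x) - 1 - \<i> * of_real (u * x) * indicator {x. \<bar>x\<bar> \<le> 1} x) \<circ> v)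
      \<longlonglongrightarrow> (CLINT x|\<nu>. iexp (u * x) - 1 - \<i> * of_real (u * x) * indicator {x. \<bar>x\<bar> \<le> 1} x)"
      unfolding comp_def
    proof (rule integral_dominated_convergence[where w = "\<lambda>x. (2 + K\<^sup>2) * min 1 (x\<^sup>2)"])
      show "AE x in \<nu>. norm (iexp (v n * x) - 1 - \<i> * of_real (v n * x) * indicator {x. \<bar>x\<bar> \<le> 1} x)
        \<le> (2 + K\<^sup>2) * min 1 (x\<^sup>2)" for n
      proof (rule AE_I2)
        fix x
        have "(v n)\<^sup>2 \<le> K\<^sup>2" using K[of n] by (rule power2_le_iff_abs_le[THEN iffD2, rotated]) (use K[of n] in auto)
        then have "(2 + (v n)\<^sup>2) * min 1 (x\<^sup>2) \<le> (2 + K\<^sup>2) * min 1 (x\<^sup>2)"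
          by (intro mult_right_mono) auto
        with levy_integrand_bound[of "v n" x]
        show "norm (iexp (v n * x) - 1 - \<i> * of_real (v n * x) * indicator {x. \<bar>x\<bar> \<le> 1} x)
          \<le> (2 + K\<^sup>2) * min 1 (x\<^sup>2)" by linarith
      qed
    qed (use int in \<open>auto intro!: tendsto_intros v\<close>)
  qed
  then show ?thesis
    unfolding levy_exponent_def
    by (intro continuous_intros continuous_at_imp_continuous_on) auto
qed

lemma levy_exponent_0 [simp]: "levy_exponent \<gamma> \<Sigma> \<nu> 0 = 0"
  by (simp add: levy_exponent_def)

section \<open>Bounded Borel sets and simple integrands\<close>

lemma bounded_borel_subset:
  assumes "C \<in> bounded_borel" "D \<subseteq> C" "D \<in> sets borel"
  shows "D \<in> bounded_borel"
  using assms by (auto simp: bounded_borel_def intro: bounded_subset)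

lemma bounded_borel_empty [simp]: "{} \<in> bounded_borel"
  by (simp add: bounded_borel_def)

lemma bounded_borel_Un: "C \<in> bounded_borel \<Longrightarrow> D \<in> bounded_borel \<Longrightarrow> C \<union> D \<in> bounded_borel"
  by (auto simp: bounded_borel_def)

lemma bounded_borel_UN:
  "finite I \<Longrightarrow> (\<And>i. i \<in> I \<Longrightarrow> C i \<in> bounded_borel) \<Longrightarrow> (\<Union>i\<in>I. C i) \<in> bounded_borel"
  by (induction I rule: finite_induct) (auto intro: bounded_borel_Un)

lemma bounded_borel_Int: "C \<in> bounded_borel \<Longrightarrow> D \<in> sets borel \<Longrightarrow> C \<inter> D \<in> bounded_borel"
  by (rule bounded_borel_subset[of C]) (auto simp: bounded_borel_def)

lemma bounded_borel_sets: "C \<in> bounded_borel \<Longrightarrow> C \<in> sets borel"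
  by (simp add: bounded_borel_def)

lemma half_plane_borel: "half_plane \<in> sets borel"
  by (metis borel_prod lessThan_borel pair_measureI sets.top space_borel)

text \<open>Measurability with a single bounded support is a condition that passes easily to sums,
  unlike a condition on level sets. The zero level is unbounded and has to be reached as the
  complement of the support.\<close>

lemma levy_simple_iff:
  "levy_simple g \<longleftrightarrow> finite (range g) \<and> g \<in> borel_measurable borel \<and> {p. g p \<noteq> 0} \<in> bounded_borel"
proof
  assume g: "levy_simple g"
  then have fin: "finite (range g)" and vim: "\<And>y. y \<noteq> 0 \<Longrightarrow> g -` {y} \<in> bounded_borel"
    by (auto simp: levy_simple_def)
  have supp: "{p. g p \<noteq> 0} = (\<Union>y\<in>range g - {0}. g -` {y})" by auto
  have bb: "{p. g p \<noteq> 0} \<in> bounded_borel"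
    unfolding supp using fin by (intro bounded_borel_UN vim) auto
  have "g -` {y} \<in> sets borel" for y
  proof (cases "y = 0")
    case True
    then have "g -` {y} = UNIV - {p. g p \<noteq> 0}" by auto
    then show ?thesis using bounded_borel_sets[OF bb] by (metis borel_comp Compl_eq_Diff_UNIV)
  qed (use vim in \<open>auto simp: bounded_borel_sets\<close>)
  then have "simple_function borel g"
    using fin by (simp add: simple_function_def)
  then show "finite (range g) \<and> g \<in> borel_measurable borel \<and> {p. g p \<noteq> 0} \<in> bounded_borel"
    using fin bb borel_measurable_simple_function by blast
next
  assume g: "finite (range g) \<and> g \<in> borel_measurable borel \<and> {p. g p \<noteq> 0} \<in> bounded_borel"
  have "g -` {y} \<in> bounded_borel" if "y \<noteq> 0" for y
  proof (rule bounded_borel_subset)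
    show "{p. g p \<noteq> 0} \<in> bounded_borel" using g by simp
    show "g -` {y} \<in> sets borel" using g measurable_sets[of g borel borel "{y}"] by simp
  qed (use that in auto)
  with g show "levy_simple g" by (auto simp: levy_simple_def)
qed

lemma levy_simple_add:
  assumes "levy_simple g" "levy_simple g'"
  shows "levy_simple (\<lambda>p. g p + g' p)"
  unfolding levy_simple_iff
proof (intro conjI)
  have "range (\<lambda>p. g p + g' p) \<subseteq> (\<lambda>(x, y). x + y) ` (range g \<times> range g')" by auto
  then show "finite (range (\<lambda>p. g p + g' p))"
    using assms by (elim finite_subset) (auto simp: levy_simple_iff)
  show m: "(\<lambda>p. g p + g' p) \<in> borel_measurable borel"
    using assms by (auto simp: levy_simple_iff)
  show "{p. g p + g' p \<noteq> 0} \<in> bounded_borel"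
  proof (rule bounded_borel_subset)
    show "{p. g p \<noteq> 0} \<union> {p. g' p \<noteq> 0} \<in> bounded_borel"
      using assms by (intro bounded_borel_Un) (auto simp: levy_simple_iff)
    show "{p. g p + g' p \<noteq> 0} \<in> sets borel" using m by measurable
  qed auto
qed

locale levy_basis_quadruple =
  fixes M :: "'a measure" and \<Lambda> :: "(real \<times> real) set \<Rightarrow> 'a \<Rightarrow> real"
    and \<gamma> \<Sigma> :: real and \<nu> \<pi> :: "real measure"
  assumes basis: "levy_basis M \<Lambda>"
    and quadruple: "has_generating_quadruple M \<Lambda> \<gamma> \<Sigma> \<nu> \<pi>"
begin

abbreviation "\<psi> \<equiv> levy_exponent \<gamma> \<Sigma> \<nu>"
abbreviation "\<rho> \<equiv> \<pi> \<Otimes>\<^sub>M lborel"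
abbreviation "step_integral \<equiv> simple_levy_integral \<Lambda>"

sublocale prob_space M
  using basis by (simp add: levy_basis_def)

sublocale \<pi>: real_distribution \<pi>
  using quadruple by (simp add: has_generating_quadruple_def)

sublocale \<rho>: pair_sigma_finite \<pi> lborel ..

lemma sets_\<rho> [measurable_cong]: "sets \<rho> = sets borel"
  by (metis \<pi>.events_eq_borel borel_prod sets_lborel sets_pair_measure_cong)

lemma space_\<rho> [simp]: "space \<rho> = UNIV"
  by (simp add: space_pair_measure)

lemma \<Lambda>_measurable [measurable (raw)]: "C \<in> bounded_borel \<Longrightarrow> \<Lambda> C \<in> borel_measurable M"
  using basis by (simp add: levy_basis_def)

lemma \<psi>_continuous: "continuous_on UNIV \<psi>"
  using quadruple by (intro continuous_levy_exponent) (simp add: has_generating_quadruple_def)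

lemma \<psi>_measurable [measurable]: "\<psi> \<in> borel_measurable borel"
  by (rule borel_measurable_continuous_onI[OF \<psi>_continuous])

lemma \<psi>_tendsto: "(f \<longlongrightarrow> x) F \<Longrightarrow> ((\<lambda>i. \<psi> (f i)) \<longlongrightarrow> \<psi> x) F"
  by (rule isCont_tendsto_compose[of x \<psi>]) (use \<psi>_continuous in \<open>simp_all add: continuous_on_eq_continuous_at\<close>)

lemma \<psi>_bounded:
  obtains K where "\<And>v. \<bar>v\<bar> \<le> r \<Longrightarrow> cmod (\<psi> v) \<le> K"
proof -
  have "compact (\<psi> ` {-r..r})"
    by (rule compact_continuous_image[OF continuous_on_subset[OF \<psi>_continuous]]) auto
  then obtain K where K: "\<forall>z\<in>\<psi> ` {-r..r}. cmod z \<le> K"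
    using compact_imp_bounded bounded_iff by metis
  show thesis
  proof (rule that)
    fix v :: real assume "\<bar>v\<bar> \<le> r"
    then have "v \<in> {-r..r}" by (simp add: abs_le_iff)
    with K show "cmod (\<psi> v) \<le> K" by blast
  qed
qed

lemma char_\<Lambda>: "C \<in> bounded_borel \<Longrightarrow> char (distr M borel (\<Lambda> C)) u = exp (\<psi> u * measure \<rho> C)"
  using quadruple by (simp add: has_generating_quadruple_def)

text \<open>A bounded set lies in a strip of finite height in the time direction, and
  \<open>\<pi>\<close> has total mass one.\<close>

lemma emeasure_\<rho>_bounded_borel:
  assumes "C \<in> bounded_borel"
  shows "emeasure \<rho> C < \<infinity>"
proof -
  obtain r where r: "\<And>p. p \<in> C \<Longrightarrow> norm p \<le> r"
    using assms by (auto simp: bounded_borel_def bounded_iff)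
  have "C \<subseteq> UNIV \<times> {-r..r}"
  proof
    fix p assume "p \<in> C"
    then show "p \<in> UNIV \<times> {-r..r}"
      using r[of p] norm_snd_le[of "snd p" "fst p"] by (cases p) (auto simp: abs_le_iff)
  qed
  then have "emeasure \<rho> C \<le> emeasure \<rho> (UNIV \<times> {-r..r})"
    by (intro emeasure_mono) auto
  also have "\<dots> = emeasure \<pi> UNIV * emeasure lborel {-r..r}"
    by (intro lborel.emeasure_pair_measure_Times) auto
  also have "\<dots> < \<infinity>"
    using \<pi>.emeasure_space_1 by (auto simp: emeasure_lborel_Icc_eq)
  finally show ?thesis .
qed

section \<open>Additivity of the Levy basis and of integrals of simple functions\<close>

lemma AE_\<Lambda>_sums:
  fixes C :: "nat \<Rightarrow> (real \<times> real) set"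
  assumes "range C \<subseteq> bounded_borel" "disjoint_family C" "bounded (\<Union>i. C i)"
  shows "AE \<omega> in M. (\<lambda>i. \<Lambda> (C i) \<omega>) sums \<Lambda> (\<Union>i. C i) \<omega>"
  using basis assms unfolding levy_basis_def by blast

text \<open>Countable additivity for the constantly empty family makes a series with constant terms
  converge, which forces its terms to vanish. This allows finite families to be padded by empty
  sets.\<close>

lemma AE_\<Lambda>_empty: "AE \<omega> in M. \<Lambda> {} \<omega> = 0"
proof -
  have "AE \<omega> in M. (\<lambda>i :: nat. \<Lambda> {} \<omega>) sums \<Lambda> {} \<omega>"
    using AE_\<Lambda>_sums[of "\<lambda>i. {}"] by (simp add: disjoint_family_on_def)
  then show ?thesis
  proof eventually_elim
    case (elim \<omega>)
    show ?case using summable_LIMSEQ_zero[OF sums_summable[OF elim]] by (simp add: LIMSEQ_const_iff)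
  qed
qed

lemma AE_\<Lambda>_Un:
  assumes "A \<in> bounded_borel" "B \<in> bounded_borel" "A \<inter> B = {}"
  shows "AE \<omega> in M. \<Lambda> (A \<union> B) \<omega> = \<Lambda> A \<omega> + \<Lambda> B \<omega>"
proof -
  define C where "C = (\<lambda>i :: nat. if i = 0 then A else if i = 1 then B else {})"
  have "C 0 = A" "C 1 = B" "C i \<subseteq> A \<union> B" for i by (auto simp: C_def)
  then have U: "(\<Union>i. C i) = A \<union> B" by blast
  have "AE \<omega> in M. (\<lambda>i. \<Lambda> (C i) \<omega>) sums \<Lambda> (\<Union>i. C i) \<omega>"
  proof (rule AE_\<Lambda>_sums)
    show "bounded (\<Union>i. C i)" unfolding U using assms by (simp add: bounded_borel_def)
  qed (use assms in \<open>auto simp: C_def disjoint_family_on_def\<close>)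
  with AE_\<Lambda>_empty show ?thesis
  proof eventually_elim
    case (elim \<omega>)
    have "(\<lambda>i. \<Lambda> (C i) \<omega>) sums (\<Sum>i\<in>{0, 1}. \<Lambda> (C i) \<omega>)"
      using elim(1) by (intro sums_finite) (auto simp: C_def)
    then have "\<Lambda> (\<Union>i. C i) \<omega> = (\<Sum>i\<in>{0, 1}. \<Lambda> (C i) \<omega>)"
      using elim(2) by (rule sums_unique2[symmetric])
    then show ?case unfolding U by (simp add: C_def)
  qed
qed

lemma AE_\<Lambda>_UN:
  assumes "finite I" "\<And>i. i \<in> I \<Longrightarrow> C i \<in> bounded_borel" "disjoint_family_on C I"
  shows "AE \<omega> in M. \<Lambda> (\<Union>i\<in>I. C i) \<omega> = (\<Sum>i\<in>I. \<Lambda> (C i) \<omega>)"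
  using assms
proof (induction I rule: finite_induct)
  case empty
  then show ?case using AE_\<Lambda>_empty by simp
next
  case (insert i I)
  have "AE \<omega> in M. \<Lambda> (C i \<union> (\<Union>j\<in>I. C j)) \<omega> = \<Lambda> (C i) \<omega> + \<Lambda> (\<Union>j\<in>I. C j) \<omega>"
    using insert by (intro AE_\<Lambda>_Un bounded_borel_UN) (auto simp: disjoint_family_on_def)
  moreover have "AE \<omega> in M. \<Lambda> (\<Union>j\<in>I. C j) \<omega> = (\<Sum>j\<in>I. \<Lambda> (C j) \<omega>)"
    using insert by (auto simp: disjoint_family_on_def)
  ultimately show ?case
    by eventually_elim (use insert in simp)
qed

lemma level_set_bounded_borel:
  "levy_simple g \<Longrightarrow> D \<in> sets borel \<Longrightarrow> y \<noteq> 0 \<Longrightarrow> g -` {y} \<inter> D \<in> bounded_borel"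
  by (intro bounded_borel_Int) (auto simp: levy_simple_def)

lemma step_integral_measurable [measurable (raw)]:
  "levy_simple g \<Longrightarrow> D \<in> sets borel \<Longrightarrow> step_integral D g \<in> borel_measurable M"
  unfolding simple_levy_integral_def
  by (intro borel_measurable_sum borel_measurable_times borel_measurable_const \<Lambda>_measurable level_set_bounded_borel)
     auto

lemma step_integral_Un:
  assumes "levy_simple g" "D \<in> sets borel" "E \<in> sets borel" "D \<inter> E = {}"
  shows "AE \<omega> in M. step_integral (D \<union> E) g \<omega> = step_integral D g \<omega> + step_integral E g \<omega>"
proof -
  have "AE \<omega> in M. \<forall>y\<in>range g - {0}. \<Lambda> (g -` {y} \<inter> (D \<union> E)) \<omega> = \<Lambda> (g -` {y} \<inter> D) \<omega> + \<Lambda> (g -` {y} \<inter> E) \<omega>"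
  proof (rule AE_finite_allI)
    fix y assume "y \<in> range g - {0}"
    then show "AE \<omega> in M. \<Lambda> (g -` {y} \<inter> (D \<union> E)) \<omega> = \<Lambda> (g -` {y} \<inter> D) \<omega> + \<Lambda> (g -` {y} \<inter> E) \<omega>"
      unfolding Int_Un_distrib using assms by (intro AE_\<Lambda>_Un level_set_bounded_borel) auto
  qed (use assms in \<open>auto simp: levy_simple_def\<close>)
  then show ?thesis
    by eventually_elim (simp add: simple_levy_integral_def sum.distrib[symmetric] algebra_simps)
qed

text \<open>The definition is tied to the level sets of one function. Freedom to cut levels into
  pieces lets two simple functions and their sum be written over a common partition.\<close>

lemma step_integral_partition:
  assumes g: "levy_simple g" and D: "D \<in> sets borel" and I: "finite I"
    and C: "\<And>i. i \<in> I \<Longrightarrow> C i \<in> bounded_borel" "disjoint_family_on C I"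
    and val: "\<And>i p. i \<in> I \<Longrightarrow> p \<in> C i \<Longrightarrow> g p = c i"
    and cover: "\<And>p. g p \<noteq> 0 \<Longrightarrow> \<exists>i\<in>I. p \<in> C i"
  shows "AE \<omega> in M. step_integral D g \<omega> = (\<Sum>i\<in>I. c i * \<Lambda> (C i \<inter> D) \<omega>)"
proof -
  \<comment> \<open>The values \<open>c i\<close> are included because a piece \<open>C i\<close>
    may be empty, and then \<open>c i\<close> need not be attained by \<open>g\<close>; such a level
    contributes \<open>\<Lambda> {}\<close>, which vanishes almost surely.\<close>
  define S where "S = (range g \<union> c ` I) - {0}"
  have S: "finite S" using g I by (simp add: S_def levy_simple_def)
  have "AE \<omega> in M. \<forall>y\<in>S. \<Lambda> (g -` {y} \<inter> D) \<omega> = (\<Sum>i\<in>{i \<in> I. c i = y}. \<Lambda> (C i \<inter> D) \<omega>)"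
  proof (rule AE_finite_allI[OF S])
    fix y assume "y \<in> S"
    then have y: "y \<noteq> 0" by (simp add: S_def)
    have level: "g -` {y} \<inter> D = (\<Union>i\<in>{i \<in> I. c i = y}. C i \<inter> D)"
    proof (rule set_eqI, rule iffI)
      fix p assume p: "p \<in> g -` {y} \<inter> D"
      then obtain i where "i \<in> I" "p \<in> C i" using cover[of p] y by auto
      with p val[of i p] show "p \<in> (\<Union>i\<in>{i \<in> I. c i = y}. C i \<inter> D)" by auto
    qed (use val in auto)
    show "AE \<omega> in M. \<Lambda> (g -` {y} \<inter> D) \<omega> = (\<Sum>i\<in>{i \<in> I. c i = y}. \<Lambda> (C i \<inter> D) \<omega>)"
      unfolding level using I C D
      by (intro AE_\<Lambda>_UN bounded_borel_Int) (auto simp: disjoint_family_on_def)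
  qed
  with AE_\<Lambda>_empty show ?thesis
  proof eventually_elim
    case (elim \<omega>)
    have "step_integral D g \<omega> = (\<Sum>y\<in>S. y * \<Lambda> (g -` {y} \<inter> D) \<omega>)"
      unfolding simple_levy_integral_def
    proof (rule sum.mono_neutral_left[OF S])
      show "\<forall>y\<in>S - (range g - {0}). y * \<Lambda> (g -` {y} \<inter> D) \<omega> = 0"
      proof
        fix y assume "y \<in> S - (range g - {0})"
        then have "g -` {y} = {}" by (auto simp: S_def)
        then show "y * \<Lambda> (g -` {y} \<inter> D) \<omega> = 0" using elim(1) by simp
      qed
    qed (auto simp: S_def)
    also have "\<dots> = (\<Sum>y\<in>S. \<Sum>i\<in>{i \<in> {i \<in> I. c i \<noteq> 0}. c i = y}. c i * \<Lambda> (C i \<inter> D) \<omega>)"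
      using elim(2) by (intro sum.cong refl) (auto simp: sum_distrib_left S_def intro!: sum.cong)
    also have "\<dots> = (\<Sum>i\<in>{i \<in> I. c i \<noteq> 0}. c i * \<Lambda> (C i \<inter> D) \<omega>)"
      using I S by (intro sum.group) (auto simp: S_def)
    also have "\<dots> = (\<Sum>i\<in>I. c i * \<Lambda> (C i \<inter> D) \<omega>)"
      using I by (intro sum.mono_neutral_left) auto
    finally show ?case .
  qed
qed

lemma step_integral_add:
  assumes g: "levy_simple g" and g': "levy_simple g'" and D: "D \<in> sets borel"
  shows "AE \<omega> in M. step_integral D (\<lambda>p. g p + g' p) \<omega> = step_integral D g \<omega> + step_integral D g' \<omega>"
proof -
  \<comment> \<open>The joint level sets of \<open>g\<close> and \<open>g'\<close>. The pair
    \<open>(0, 0)\<close> is left out since its set is unbounded, and it contributes nothing to any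
    of the three integrals.\<close>
  define I where "I = range g \<times> range g' - {(0, 0)}"
  define C where "C = (\<lambda>(y, y'). g -` {y} \<inter> g' -` {y'})"
  have I: "finite I" using g g' by (auto simp: I_def levy_simple_def)
  have C: "C i \<in> bounded_borel" if "i \<in> I" for i
  proof (rule bounded_borel_subset)
    show "{p. g p \<noteq> 0} \<union> {p. g' p \<noteq> 0} \<in> bounded_borel"
      using g g' by (intro bounded_borel_Un) (auto simp: levy_simple_iff)
    have "g -` {y} \<in> sets borel" "g' -` {y} \<in> sets borel" for y
      using g g' measurable_sets[of g borel borel "{y}"] measurable_sets[of g' borel borel "{y}"]
      by (auto simp: levy_simple_iff)
    then show "C i \<in> sets borel" by (auto simp: C_def split: prod.splits)
  qed (use that in \<open>auto simp: I_def C_def\<close>)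
  have disj: "disjoint_family_on C I" by (auto simp: disjoint_family_on_def C_def)
  have "AE \<omega> in M. step_integral D g \<omega> = (\<Sum>i\<in>I. fst i * \<Lambda> (C i \<inter> D) \<omega>)"
    by (rule step_integral_partition[OF g D I C disj]) (auto simp: C_def I_def)
  moreover have "AE \<omega> in M. step_integral D g' \<omega> = (\<Sum>i\<in>I. snd i * \<Lambda> (C i \<inter> D) \<omega>)"
    by (rule step_integral_partition[OF g' D I C disj]) (auto simp: C_def I_def)
  moreover have "AE \<omega> in M. step_integral D (\<lambda>p. g p + g' p) \<omega> = (\<Sum>i\<in>I. (fst i + snd i) * \<Lambda> (C i \<inter> D) \<omega>)"
  proof (rule step_integral_partition[OF levy_simple_add[OF g g'] D I C disj])
    show "\<exists>i\<in>I. p \<in> C i" if "g p + g' p \<noteq> 0" for p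
      by (rule bexI[of _ "(g p, g' p)"]) (use that in \<open>auto simp: C_def I_def\<close>)
  qed (auto simp: C_def I_def)
  ultimately show ?thesis
    by eventually_elim (simp add: sum.distrib[symmetric] algebra_simps)
qed

lemma has_levy_integral_add:
  assumes "has_levy_integral M \<Lambda> \<pi> f Y" "has_levy_integral M \<Lambda> \<pi> f' Y'"
  shows "has_levy_integral M \<Lambda> \<pi> (\<lambda>p. f p + f' p) (\<lambda>\<omega>. Y \<omega> + Y' \<omega>)"
proof -
  obtain g where g: "\<And>n. levy_simple (g n)" "AE p in \<rho>. (\<lambda>n. g n p) \<longlonglongrightarrow> f p"
      "\<And>D. D \<in> sets borel \<Longrightarrow> \<exists>Z\<in>borel_measurable M. tendsto_in_prob M (\<lambda>n. step_integral D (g n)) Z"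
      "tendsto_in_prob M (\<lambda>n. step_integral half_plane (g n)) Y"
    using assms(1) unfolding has_levy_integral_def by blast
  obtain g' where g': "\<And>n. levy_simple (g' n)" "AE p in \<rho>. (\<lambda>n. g' n p) \<longlonglongrightarrow> f' p"
      "\<And>D. D \<in> sets borel \<Longrightarrow> \<exists>Z\<in>borel_measurable M. tendsto_in_prob M (\<lambda>n. step_integral D (g' n)) Z"
      "tendsto_in_prob M (\<lambda>n. step_integral half_plane (g' n)) Y'"
    using assms(2) unfolding has_levy_integral_def by blast
  have [measurable]: "f \<in> borel_measurable borel" "f' \<in> borel_measurable borel"
      "Y \<in> borel_measurable M" "Y' \<in> borel_measurable M"
    using assms by (auto simp: has_levy_integral_def)
  note half = half_plane_borel
  have add: "tendsto_in_prob M (\<lambda>n. step_integral D (\<lambda>p. g n p + g' n p)) (\<lambda>\<omega>. Z \<omega> + Z' \<omega>)"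
    if "D \<in> sets borel" "Z \<in> borel_measurable M" "Z' \<in> borel_measurable M"
      "tendsto_in_prob M (\<lambda>n. step_integral D (g n)) Z"
      "tendsto_in_prob M (\<lambda>n. step_integral D (g' n)) Z'" for D Z Z'
    using that g(1) g'(1)
    by (intro tendsto_in_prob_add[where Y = "\<lambda>n. step_integral D (g n)" and Y' = "\<lambda>n. step_integral D (g' n)"]
      step_integral_add step_integral_measurable levy_simple_add) auto
  show ?thesis
    unfolding has_levy_integral_def
  proof (intro conjI exI[of _ "\<lambda>n p. g n p + g' n p"] allI ballI levy_simple_add g g' add half)
    show "AE p in \<rho>. (\<lambda>n. g n p + g' n p) \<longlonglongrightarrow> f p + f' p"
      using g(2) g'(2) by eventually_elim (rule tendsto_add)
    fix D :: "(real \<times> real) set" assume D: "D \<in> sets borel"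
    then obtain Z Z' where Z: "Z \<in> borel_measurable M" "tendsto_in_prob M (\<lambda>n. step_integral D (g n)) Z"
      "Z' \<in> borel_measurable M" "tendsto_in_prob M (\<lambda>n. step_integral D (g' n)) Z'"
      using g(3) g'(3) by blast
    then show "\<exists>Z\<in>borel_measurable M. tendsto_in_prob M (\<lambda>n. step_integral D (\<lambda>p. g n p + g' n p)) Z"
      by (intro bexI[of _ "\<lambda>\<omega>. Z \<omega> + Z' \<omega>"] add D) auto
  qed auto
qed

text \<open>Level sets are disjoint, so the values of \<open>\<Lambda>\<close> on them are
  independent and the characteristic function is a product. The resulting sum in the exponent is an
  integral over all of \<open>D\<close> because \<open>\<psi>\<close> vanishes at \<open>0\<close>,
  where \<open>g\<close> may have infinite measure.\<close>

lemma char_step_integral: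
  assumes g: "levy_simple g" and D: "D \<in> sets borel"
  shows "char (distr M borel (step_integral D g)) u = exp (CLINT p|\<rho>. indicat_real D p *\<^sub>R \<psi> (u * g p))"
proof -
  define S where "S = range g - {0}"
  have S: "finite S" using g by (simp add: S_def levy_simple_def)
  \<comment> \<open>Independence of a Levy basis is stated for sequences of sets, so the finitely
    many values are enumerated and the sequence of level sets is continued by empty sets.\<close>
  then obtain e where e: "bij_betw e {0..<card S} S"
    using ex_bij_betw_nat_finite by blast
  define n where "n = card S"
  have eS: "e i \<in> S" if "i < n" for i
    using e that by (auto simp: bij_betw_def n_def)
  define C where "C = (\<lambda>i. if i < n then g -` {e i} \<inter> D else {})"
  have C: "C i \<in> bounded_borel" for i
    using eS[of i] g D by (auto simp: C_def S_def intro!: level_set_bounded_borel)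
  have "disjoint_family C"
    using e by (auto simp: disjoint_family_on_def C_def n_def bij_betw_def inj_on_def)
  then have "indep_vars (\<lambda>_. borel) (\<lambda>i. \<Lambda> (C i)) UNIV"
    using basis C unfolding levy_basis_def by blast
  then have "indep_vars (\<lambda>_. borel) (\<lambda>i. \<Lambda> (C i)) {0..<n}"
    by (rule indep_vars_subset) auto
  then have indep: "indep_vars (\<lambda>_. borel) (\<lambda>i \<omega>. e i * \<Lambda> (C i) \<omega>) {0..<n}"
    by (rule indep_vars_compose2) auto
  have char_scale: "char (distr M borel (\<lambda>\<omega>. e i * \<Lambda> (C i) \<omega>)) u = exp (measure \<rho> (C i) *\<^sub>R \<psi> (u * e i))" for i
  proof -
    have "char (distr M borel (\<lambda>\<omega>. e i * \<Lambda> (C i) \<omega>)) u = char (distr M borel (\<Lambda> (C i))) (u * e i)"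
      using C[of i] by (simp add: char_def integral_distr mult.assoc)
    then show ?thesis by (simp add: char_\<Lambda>[OF C] scaleR_conv_of_real mult.commute)
  qed
  have "step_integral D g \<omega> = (\<Sum>i\<in>{0..<n}. e i * \<Lambda> (C i) \<omega>)" for \<omega>
  proof -
    have "step_integral D g \<omega> = (\<Sum>y\<in>S. y * \<Lambda> (g -` {y} \<inter> D) \<omega>)"
      by (simp add: simple_levy_integral_def S_def)
    also have "\<dots> = (\<Sum>i\<in>{0..<n}. e i * \<Lambda> (g -` {e i} \<inter> D) \<omega>)"
      using sum.reindex_bij_betw[OF e, of "\<lambda>y. y * \<Lambda> (g -` {y} \<inter> D) \<omega>"] by (simp add: n_def)
    finally show ?thesis by (simp add: C_def)
  qed
  then have "step_integral D g = (\<lambda>\<omega>. \<Sum>i\<in>{0..<n}. e i * \<Lambda> (C i) \<omega>)" by (rule ext)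
  then have "char (distr M borel (step_integral D g)) u
      = char (distr M borel (\<lambda>\<omega>. \<Sum>i\<in>{0..<n}. e i * \<Lambda> (C i) \<omega>)) u"
    by (rule arg_cong)
  also have "\<dots> = (\<Prod>i\<in>{0..<n}. exp (measure \<rho> (C i) *\<^sub>R \<psi> (u * e i)))"
    unfolding char_distr_sum[OF indep] char_scale ..
  also have "\<dots> = exp (\<Sum>i\<in>{0..<n}. measure \<rho> (g -` {e i} \<inter> D) *\<^sub>R \<psi> (u * e i))"
    by (simp add: exp_sum C_def)
  also have "(\<Sum>i\<in>{0..<n}. measure \<rho> (g -` {e i} \<inter> D) *\<^sub>R \<psi> (u * e i))
      = (\<Sum>y\<in>S. measure \<rho> (g -` {y} \<inter> D) *\<^sub>R \<psi> (u * y))"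
    using sum.reindex_bij_betw[OF e, of "\<lambda>y. measure \<rho> (g -` {y} \<inter> D) *\<^sub>R \<psi> (u * y)"] by (simp add: n_def)
  also have "\<dots> = (CLINT p|\<rho>. (\<Sum>y\<in>S. indicat_real (g -` {y} \<inter> D) p *\<^sub>R \<psi> (u * y)))"
  proof -
    have b: "g -` {y} \<inter> D \<in> bounded_borel" if "y \<in> S" for y
      using that g D by (intro level_set_bounded_borel) (auto simp: S_def)
    have "integrable \<rho> (indicat_real (g -` {y} \<inter> D))" if "y \<in> S" for y
      using emeasure_\<rho>_bounded_borel[OF b[OF that]] bounded_borel_sets[OF b[OF that]]
      by (intro integrable_real_indicator) (simp_all only: sets_\<rho> infinity_ennreal_def)
    then show ?thesis
      by (subst Bochner_Integration.integral_sum) auto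
  qed
  also have "\<dots> = (CLINT p|\<rho>. indicat_real D p *\<^sub>R \<psi> (u * g p))"
  proof (rule Bochner_Integration.integral_cong[OF refl])
    fix p
    have "(\<Sum>y\<in>S. indicat_real (g -` {y} \<inter> D) p *\<^sub>R \<psi> (u * y))
        = (\<Sum>y\<in>S. if y = g p then indicat_real D p *\<^sub>R \<psi> (u * g p) else 0)"
      by (intro sum.cong refl) (auto simp: indicator_def)
    also have "\<dots> = indicat_real D p *\<^sub>R \<psi> (u * g p)"
      using S by (auto simp: sum.delta S_def)
    finally show "(\<Sum>y\<in>S. indicat_real (g -` {y} \<inter> D) p *\<^sub>R \<psi> (u * y)) = indicat_real D p *\<^sub>R \<psi> (u * g p)" .
  qed
  finally show ?thesis .
qed

text \<open>Along sets whose measure tends to zero the characteristic functions tend to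
  \<open>1\<close>. The Levy continuity theorem gives weak convergence to the point mass at
  \<open>0\<close>, and \<open>min 1 |x|\<close> is a bounded continuous test function.\<close>

lemma \<Lambda>_small:
  assumes "0 < e"
  shows "\<exists>d>0. \<forall>C\<in>bounded_borel. measure \<rho> C < d \<longrightarrow> L0norm M (\<lambda>\<omega>. c * \<Lambda> C \<omega>) \<le> e"
proof (rule ccontr)
  assume no: "\<not> ?thesis"
  have "\<exists>C\<in>bounded_borel. measure \<rho> C < 1 / real (Suc n) \<and> e < L0norm M (\<lambda>\<omega>. c * \<Lambda> C \<omega>)" for n
  proof -
    have "0 < 1 / real (Suc n)" by simp
    then show ?thesis using no not_le by metis
  qed
  then obtain C where C: "\<And>n. C n \<in> bounded_borel" "\<And>n. measure \<rho> (C n) < 1 / real (Suc n)"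
      "\<And>n. e < L0norm M (\<lambda>\<omega>. c * \<Lambda> (C n) \<omega>)"
    by metis
  note [measurable] = \<Lambda>_measurable[OF C(1)]
  have to0: "(\<lambda>n. measure \<rho> (C n)) \<longlonglongrightarrow> 0"
    by (rule tendsto_sandwich[OF _ _ tendsto_const LIMSEQ_inverse_real_of_nat])
       (use C(2) in \<open>auto intro!: always_eventually less_imp_le simp: inverse_eq_divide\<close>)
  define N where "N n = distr M borel (\<lambda>\<omega>. c * \<Lambda> (C n) \<omega>)" for n
  have N: "real_distribution (N n)" for n
    unfolding N_def by (rule real_distribution_distr) simp
  have R: "real_distribution (return borel 0 :: real measure)"
    by (intro real_distribution.intro prob_space_return real_distribution_axioms.intro) auto
  have "weak_conv_m N (return borel 0)"
  proof (rule levy_continuity[OF N R])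
    fix u
    have "(\<lambda>n. exp (measure \<rho> (C n) *\<^sub>R \<psi> (u * c))) \<longlonglongrightarrow> exp (0 *\<^sub>R \<psi> (u * c))"
      by (intro tendsto_intros to0)
    moreover have "char (N n) u = exp (measure \<rho> (C n) *\<^sub>R \<psi> (u * c))" for n
    proof -
      have "char (N n) u = char (distr M borel (\<Lambda> (C n))) (u * c)"
        by (simp add: N_def char_def integral_distr mult.assoc)
      then show ?thesis by (simp add: char_\<Lambda>[OF C(1)] scaleR_conv_of_real mult.commute)
    qed
    moreover have "char (return borel 0) u = 1"
      by (simp add: char_def integral_return)
    ultimately show "(\<lambda>n. char (N n) u) \<longlonglongrightarrow> char (return borel 0) u" by simp
  qed
  then have "(\<lambda>n. integral\<^sup>L (N n) (\<lambda>x. min 1 \<bar>x\<bar>)) \<longlonglongrightarrow> integral\<^sup>L (return borel 0) (\<lambda>x. min 1 \<bar>x\<bar>)"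
    by (rule weak_conv_imp_integral_bdd_continuous_conv[OF N R, where B = 1]) (auto intro!: continuous_intros)
  then have "(\<lambda>n. L0norm M (\<lambda>\<omega>. c * \<Lambda> (C n) \<omega>)) \<longlonglongrightarrow> 0"
    by (simp add: N_def integral_distr integral_return L0norm_def)
  then have "\<forall>\<^sub>F n in sequentially. L0norm M (\<lambda>\<omega>. c * \<Lambda> (C n) \<omega>) < e"
    using assms by (rule order_tendstoD)
  then show False
    using C(3) by (auto simp: eventually_sequentially dest: less_asym)
qed

text \<open>A finite measure with the same null sets as \<open>\<rho>\<close>, so that the measure algebra of \<open>\<rho>\<close> becomes
  a complete metric space.\<close>

definition \<tau> :: "(real \<times> real) measure" where
  "\<tau> = density \<rho> (\<lambda>p. ennreal (std_normal_density (snd p)))"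

lemma sets_\<tau> [measurable_cong]: "sets \<tau> = sets borel"
  by (simp only: \<tau>_def sets_density sets_\<rho>)

lemma space_\<tau> [simp]: "space \<tau> = UNIV"
  by (simp add: \<tau>_def)

lemma snd_measurable_\<rho> [measurable]: "snd \<in> borel_measurable \<rho>"
  using measurable_snd[of \<pi> lborel] by simp

lemma emeasure_\<tau>_space: "emeasure \<tau> UNIV = 1"
proof -
  have "emeasure \<tau> UNIV = (\<integral>\<^sup>+p. ennreal (std_normal_density (snd p)) \<partial>\<rho>)"
    unfolding \<tau>_def using sets.top[of \<rho>] by (subst emeasure_density) simp_all
  also have "\<dots> = (\<integral>\<^sup>+A. \<integral>\<^sup>+s. ennreal (std_normal_density s) \<partial>lborel \<partial>\<pi>)"
    by (subst lborel.nn_integral_fst[symmetric]) auto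
  also have "(\<integral>\<^sup>+s. ennreal (std_normal_density s) \<partial>lborel) = 1"
    by (simp add: nn_integral_eq_integral integral_normal_density)
  finally show ?thesis using \<pi>.emeasure_space_1 by simp
qed

sublocale \<tau>: prob_space \<tau>
  by (rule prob_spaceI) (simp add: emeasure_\<tau>_space)

lemma AE_\<tau>: "AE p in \<rho>. P p \<Longrightarrow> AE p in \<tau>. P p"
  unfolding \<tau>_def by (subst AE_density) auto

text \<open>On a bounded set the time coordinate is at most \<open>r\<close> in absolute value,
  where the Gaussian weight is at least its value at \<open>r\<close>. The constant \<open>k\<close>
  is the reciprocal of that value.\<close>

lemma \<rho>_le_\<tau>:
  assumes C: "C \<in> bounded_borel"
  obtains k where "0 < k" "\<And>D. D \<in> sets borel \<Longrightarrow> measure \<rho> (C \<inter> D) \<le> k * measure \<tau> D"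
proof -
  obtain r where r: "\<And>p. p \<in> C \<Longrightarrow> norm p \<le> r"
    using C by (auto simp: bounded_borel_def bounded_iff)
  define c where "c = std_normal_density r"
  have c: "0 < c" by (simp add: c_def normal_density_pos)
  have low: "c \<le> std_normal_density (snd p)" if "p \<in> C" for p
  proof -
    have "\<bar>snd p\<bar> \<le> r"
      using r[OF that] norm_snd_le[of "snd p" "fst p"] by simp
    then have "(snd p)\<^sup>2 \<le> r\<^sup>2" using abs_le_square_iff[of "snd p" r] by simp
    then show ?thesis by (simp add: c_def normal_density_def divide_right_mono)
  qed
  have "measure \<rho> (C \<inter> D) \<le> 1 / c * measure \<tau> D" if D: "D \<in> sets borel" for D
  proof -
    have CD: "C \<inter> D \<in> bounded_borel" by (rule bounded_borel_Int[OF C D])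
    have [measurable]: "D \<in> sets \<rho>" "C \<inter> D \<in> sets \<rho>"
      unfolding sets_\<rho> using D bounded_borel_sets[OF CD] by auto
    have "ennreal c * emeasure \<rho> (C \<inter> D) = (\<integral>\<^sup>+p. ennreal c * indicator (C \<inter> D) p \<partial>\<rho>)"
      by (rule nn_integral_cmult_indicator[symmetric]) measurable
    also have "\<dots> \<le> (\<integral>\<^sup>+p. ennreal (std_normal_density (snd p)) * indicator D p \<partial>\<rho>)"
      by (intro nn_integral_mono) (auto simp: indicator_def intro!: ennreal_leI low)
    also have "\<dots> = emeasure \<tau> D"
      unfolding \<tau>_def using \<open>D \<in> sets \<rho>\<close> by (subst emeasure_density) simp_all
    finally have "ennreal c * ennreal (measure \<rho> (C \<inter> D)) \<le> ennreal (measure \<tau> D)"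
      using emeasure_\<rho>_bounded_borel[OF CD] by (simp add: \<tau>.emeasure_eq_measure emeasure_eq_ennreal_measure less_top)
    then have "c * measure \<rho> (C \<inter> D) \<le> measure \<tau> D"
      using c by (simp add: ennreal_mult'[symmetric])
    then show ?thesis using c by (simp add: field_simps)
  qed
  then show thesis using that[of "1 / c"] c by simp
qed

text \<open>This is the continuity hypothesis of the Vitali-Hahn-Saks argument for a single simple
  function: finitely many levels inside one bounded support, each controlled by
  \<open>\<Lambda>_small\<close>.\<close>

lemma step_integral_absolutely_continuous:
  assumes g: "levy_simple g" and e: "0 < e"
  shows "\<exists>d>0. \<forall>D\<in>sets borel. measure \<tau> D < d \<longrightarrow> L0norm M (step_integral D g) \<le> e"
proof -
  define S where "S = range g - {0}"
  have S: "finite S" using g by (simp add: S_def levy_simple_def)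
  have supp: "{p. g p \<noteq> 0} \<in> bounded_borel" using g by (simp add: levy_simple_iff)
  obtain k where k: "0 < k" "\<And>D. D \<in> sets borel \<Longrightarrow> measure \<rho> ({p. g p \<noteq> 0} \<inter> D) \<le> k * measure \<tau> D"
    using \<rho>_le_\<tau>[OF supp] by blast
  \<comment> \<open>The added one keeps the denominator positive when \<open>g\<close> vanishes; the
    inserted \<open>1\<close> in \<open>d0\<close> below serves the same purpose for the
    minimum.\<close>
  define e' where "e' = e / (card S + 1)"
  have e': "0 < e'" using e by (simp add: e'_def)
  obtain d where d: "\<And>y. 0 < d y"
      "\<And>y C. C \<in> bounded_borel \<Longrightarrow> measure \<rho> C < d y \<Longrightarrow> L0norm M (\<lambda>\<omega>. y * \<Lambda> C \<omega>) \<le> e'"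
    using \<Lambda>_small[OF e'] by metis
  define d0 where "d0 = Min (insert 1 (d ` S))"
  have d0: "0 < d0" "\<And>y. y \<in> S \<Longrightarrow> d0 \<le> d y"
    using S d(1) by (auto simp: d0_def)
  have "L0norm M (step_integral D g) \<le> e" if D: "D \<in> sets borel" "measure \<tau> D < d0 / k" for D
  proof -
    have b: "g -` {y} \<inter> D \<in> bounded_borel" if "y \<in> S" for y
      using that g D by (intro level_set_bounded_borel) (auto simp: S_def)
    have small: "L0norm M (\<lambda>\<omega>. y * \<Lambda> (g -` {y} \<inter> D) \<omega>) \<le> e'" if "y \<in> S" for y
    proof (rule d(2)[OF b[OF that]])
      have SD: "{p. g p \<noteq> 0} \<inter> D \<in> bounded_borel" using supp D(1) by (rule bounded_borel_Int)
      have "measure \<rho> (g -` {y} \<inter> D) \<le> measure \<rho> ({p. g p \<noteq> 0} \<inter> D)"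
      proof (rule measure_mono_fmeasurable)
        show "g -` {y} \<inter> D \<in> sets \<rho>"
          unfolding sets_\<rho> by (rule bounded_borel_sets[OF b[OF that]])
        show "{p. g p \<noteq> 0} \<inter> D \<in> fmeasurable \<rho>"
          using bounded_borel_sets[OF SD] emeasure_\<rho>_bounded_borel[OF SD]
          by (intro fmeasurableI) (simp_all only: sets_\<rho>)
      qed (use that in \<open>auto simp: S_def\<close>)
      also have "\<dots> \<le> k * measure \<tau> D" by (rule k(2)[OF D(1)])
      also have "\<dots> < d0" using D(2) k(1) by (simp add: field_simps)
      finally show "measure \<rho> (g -` {y} \<inter> D) < d y" using d0(2)[OF that] by simp
    qed
    have "L0norm M (step_integral D g) = L0norm M (\<lambda>\<omega>. \<Sum>y\<in>S. y * \<Lambda> (g -` {y} \<inter> D) \<omega>)"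
      by (simp add: simple_levy_integral_def[abs_def] S_def)
    also have "\<dots> \<le> (\<Sum>y\<in>S. L0norm M (\<lambda>\<omega>. y * \<Lambda> (g -` {y} \<inter> D) \<omega>))"
      using S b by (intro L0norm_sum_le) auto
    also have "\<dots> \<le> (\<Sum>y\<in>S. e')" by (intro sum_mono small)
    also have "\<dots> \<le> e" using e by (simp add: e'_def field_simps)
    finally show ?thesis .
  qed
  then show ?thesis using d0(1) k(1) by (intro exI[of _ "d0 / k"]) auto
qed

text \<open>The set functions \<open>D \<mapsto> step_integral D (g n)\<close> take values in random
  variables and are additive only up to null sets. Measured by \<open>L0norm\<close>, which ignores
  null sets, they fit the abstract argument.\<close>

lemma step_integrals_uniformly_absolutely_continuous:
  assumes g: "\<And>n. levy_simple (g n)"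
    and lim: "\<And>D. D \<in> sets borel \<Longrightarrow> \<exists>Z\<in>borel_measurable M. tendsto_in_prob M (\<lambda>n. step_integral D (g n)) Z"
    and e: "0 < e"
  obtains d N where "0 < d"
    "\<And>n D. N \<le> n \<Longrightarrow> D \<in> sets borel \<Longrightarrow> measure \<tau> D < d \<Longrightarrow> L0norm M (step_integral D (g n)) \<le> e"
proof -
  define nrm where "nrm = (\<lambda>n D. L0norm M (step_integral D (g n)))"
  define dst where "dst = (\<lambda>n k D. L0norm M (\<lambda>\<omega>. step_integral D (g n) \<omega> - step_integral D (g k) \<omega>))"
  have meas [measurable]: "step_integral D (g n) \<in> borel_measurable M" if "D \<in> sets borel" for n D
    using g that by (rule step_integral_measurable)
  have dst_Un_eq: "dst n k (D \<union> E) = L0norm M (\<lambda>\<omega>. (step_integral D (g n) \<omega> - step_integral D (g k) \<omega>)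
      + (step_integral E (g n) \<omega> - step_integral E (g k) \<omega>))"
    if "D \<in> sets borel" "E \<in> sets borel" "D \<inter> E = {}" for n k D E
    unfolding dst_def
  proof (rule L0norm_cong_AE)
    show "AE \<omega> in M. step_integral (D \<union> E) (g n) \<omega> - step_integral (D \<union> E) (g k) \<omega> =
      (step_integral D (g n) \<omega> - step_integral D (g k) \<omega>) + (step_integral E (g n) \<omega> - step_integral E (g k) \<omega>)"
      using step_integral_Un[OF g[of n] that] step_integral_Un[OF g[of k] that] by eventually_elim simp
  qed (use that in auto)
  show thesis
  proof (rule \<tau>.Vitali_Hahn_Saks[of nrm dst e])
    show "\<exists>d>0. \<forall>D\<in>sets \<tau>. measure \<tau> D < d \<longrightarrow> nrm n D \<le> e" if "0 < e" for n e
      using step_integral_absolutely_continuous[OF g that] by (simp add: nrm_def sets_\<tau>)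
    show "\<exists>N. \<forall>n\<ge>N. \<forall>k\<ge>N. dst n k D \<le> e" if D: "D \<in> sets \<tau>" and e: "0 < e" for D e
    proof -
      have D': "D \<in> sets borel" using D by (simp add: sets_\<tau>)
      obtain Z where [measurable]: "Z \<in> borel_measurable M" and Z: "tendsto_in_prob M (\<lambda>n. step_integral D (g n)) Z"
        using lim[OF D'] by blast
      have "(\<lambda>n. L0norm M (\<lambda>\<omega>. step_integral D (g n) \<omega> - Z \<omega>)) \<longlonglongrightarrow> 0"
        using D' by (intro tendsto_in_prob_L0norm[OF _ _ Z]) auto
      then have "\<forall>\<^sub>F n in sequentially. L0norm M (\<lambda>\<omega>. step_integral D (g n) \<omega> - Z \<omega>) < e / 2"
        by (rule order_tendstoD) (use e in auto)
      then obtain N where N: "\<And>n. N \<le> n \<Longrightarrow> L0norm M (\<lambda>\<omega>. step_integral D (g n) \<omega> - Z \<omega>) < e / 2"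
        by (auto simp: eventually_sequentially)
      have "dst n k D \<le> e" if "N \<le> n" "N \<le> k" for n k
      proof -
        have "dst n k D = L0norm M (\<lambda>\<omega>. (step_integral D (g n) \<omega> - Z \<omega>) - (step_integral D (g k) \<omega> - Z \<omega>))"
          by (simp add: dst_def)
        also have "\<dots> \<le> L0norm M (\<lambda>\<omega>. step_integral D (g n) \<omega> - Z \<omega>) + L0norm M (\<lambda>\<omega>. step_integral D (g k) \<omega> - Z \<omega>)"
          using D' by (intro L0norm_triangle_diff) auto
        finally show ?thesis using N[OF that(1)] N[OF that(2)] by linarith
      qed
      then show ?thesis by blast
    qed
    show "dst n k (D \<union> E) \<le> dst n k D + dst n k E"
      if "D \<in> sets \<tau>" "E \<in> sets \<tau>" "D \<inter> E = {}" for n k D E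
      using that unfolding sets_\<tau> by (subst dst_Un_eq) (auto simp: dst_def intro!: L0norm_triangle)
    show "dst n k D \<le> dst n k (D \<union> E) + dst n k E"
      if "D \<in> sets \<tau>" "E \<in> sets \<tau>" "D \<inter> E = {}" for n k D E
    proof -
      have [measurable]: "D \<in> sets borel" "E \<in> sets borel" using that by (auto simp: sets_\<tau>)
      let ?d = "\<lambda>D \<omega>. step_integral D (g n) \<omega> - step_integral D (g k) \<omega>"
      have "dst n k D = L0norm M (\<lambda>\<omega>. (?d D \<omega> + ?d E \<omega>) - ?d E \<omega>)"
        by (simp add: dst_def)
      also have "\<dots> \<le> L0norm M (\<lambda>\<omega>. ?d D \<omega> + ?d E \<omega>) + L0norm M (?d E)"
        by (intro L0norm_triangle_diff) auto
      also have "\<dots> = dst n k (D \<union> E) + dst n k E"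
        using that by (subst dst_Un_eq) (auto simp: dst_def)
      finally show ?thesis .
    qed
    show "dst n k D \<le> nrm n D + nrm k D" if "D \<in> sets \<tau>" for n k D
      using that by (auto simp: dst_def nrm_def sets_\<tau> intro!: L0norm_triangle_diff)
    show "nrm n D \<le> dst n k D + nrm k D" if "D \<in> sets \<tau>" for n k D
      using L0norm_triangle[of "\<lambda>\<omega>. step_integral D (g n) \<omega> - step_integral D (g k) \<omega>" "step_integral D (g k)"] that
      by (simp add: dst_def nrm_def sets_\<tau>)
  qed (use e that in \<open>auto simp: nrm_def sets_\<tau>\<close>)
qed

section \<open>The characteristic function of an integral with respect to the Levy basis\<close>

lemma AE_\<rho>_negative: "AE p in \<rho>. fst p < 0"
proof (rule \<rho>.AE_pair_measure)
  have [measurable]: "fst \<in> \<rho> \<rightarrow>\<^sub>M borel"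
    using measurable_fst[of \<pi> lborel] by (simp add: measurable_cong_sets[OF refl \<pi>.events_eq_borel])
  show "{p \<in> space \<rho>. fst p < 0} \<in> sets \<rho>" by measurable
  have "AE A in \<pi>. A < 0" using quadruple by (simp add: has_generating_quadruple_def)
  then show "AE A in \<pi>. AE s in lborel. fst (A, s) < 0" by eventually_elim simp
qed

theorem char_levy_integral:
  assumes Y: "has_levy_integral M \<Lambda> \<pi> f Y" and f_bound: "\<And>p. \<bar>f p\<bar> \<le> c"
    and int: "integrable \<rho> (\<lambda>p. \<psi> (u * f p))"
  shows "char (distr M borel Y) u = exp (CLINT p|\<rho>. \<psi> (u * f p))"
proof -
  obtain g where g: "\<And>n. levy_simple (g n)" and g_lim: "AE p in \<rho>. (\<lambda>n. g n p) \<longlonglongrightarrow> f p"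
    and g_conv: "\<And>D. D \<in> sets borel \<Longrightarrow> \<exists>Z\<in>borel_measurable M. tendsto_in_prob M (\<lambda>n. step_integral D (g n)) Z"
    and g_Y: "tendsto_in_prob M (\<lambda>n. step_integral half_plane (g n)) Y"
    using Y unfolding has_levy_integral_def by blast
  have [measurable]: "f \<in> borel_measurable borel" "Y \<in> borel_measurable M"
    using Y by (auto simp: has_levy_integral_def)
  have [measurable]: "g n \<in> borel_measurable borel" for n
    using g[of n] by (simp add: levy_simple_iff)
  note half [measurable] = half_plane_borel
  note meas [measurable] = step_integral_measurable[OF g]
  \<comment> \<open>Since \<open>\<rho>\<close> has infinite mass, a constant majorant is integrable
    only after restriction to a bounded set such as \<open>K r\<close>.\<close>
  define K where "K r = half_plane \<inter> cball 0 (real r)" for r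
  have K: "K r \<in> bounded_borel" for r
    unfolding bounded_borel_def K_def using half by (auto intro: bounded_subset[OF bounded_cball])
  note K_sets [measurable] = bounded_borel_sets[OF K]
  have K_ev: "\<forall>\<^sub>F r in sequentially. p \<in> K r" if "fst p < 0" for p
  proof -
    obtain r0 where "norm p \<le> real r0" using real_arch_simple by blast
    then have "p \<in> K r" if "r0 \<le> r" for r
      using that \<open>fst p < 0\<close> by (cases p) (auto simp: K_def)
    then show ?thesis unfolding eventually_sequentially by blast
  qed
  define a where "a r = exp (CLINT p|\<rho>. indicat_real (K r) p *\<^sub>R \<psi> (u * f p))" for r
  define a' where "a' = exp (CLINT p|\<rho>. \<psi> (u * f p))"
  have "a \<longlonglongrightarrow> a'"
    unfolding a_def a'_def
  proof (rule tendsto_exp, rule integral_dominated_convergence[where w = "\<lambda>p. cmod (\<psi> (u * f p))"])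
    show "AE p in \<rho>. (\<lambda>r. indicat_real (K r) p *\<^sub>R \<psi> (u * f p)) \<longlonglongrightarrow> \<psi> (u * f p)"
      using AE_\<rho>_negative
    proof eventually_elim
      case (elim p)
      show ?case
        by (rule tendsto_eventually, rule eventually_mono[OF K_ev[OF elim]]) simp
    qed
  qed (use int in \<open>auto simp: indicator_def\<close>)
  \<comment> \<open>Discarding small sets costs \<open>(2 + |u|) * e\<close> by
    \<open>char_diff_le_L0norm\<close>, and replacing \<open>a r\<close> by its limit
    \<open>a'\<close> costs another \<open>e\<close>.\<close>
  have bound: "cmod (char (distr M borel Y) u - a') \<le> (3 + \<bar>u\<bar>) * e" if e: "0 < e" for e
  proof -
    obtain d N where d: "0 < d" and small:
      "\<And>n D. N \<le> n \<Longrightarrow> D \<in> sets borel \<Longrightarrow> measure \<tau> D < d \<Longrightarrow> L0norm M (step_integral D (g n)) \<le> e"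
      using step_integrals_uniformly_absolutely_continuous[OF g g_conv e] by blast
    have "(\<lambda>r. measure \<tau> (half_plane - K r)) \<longlonglongrightarrow> measure \<tau> (\<Inter>r. half_plane - K r)"
    proof (rule \<tau>.finite_Lim_measure_decseq)
      show "range (\<lambda>r. half_plane - K r) \<subseteq> sets \<tau>"
        unfolding sets_\<tau> using half K_sets by auto
      show "decseq (\<lambda>r. half_plane - K r)" by (auto simp: decseq_def K_def)
    qed
    moreover have "(\<Inter>r. half_plane - K r) = {}"
    proof -
      have "\<exists>r. p \<in> K r" if "p \<in> half_plane" for p
        using K_ev[of p] that unfolding eventually_sequentially by fastforce
      then show ?thesis by blast
    qed
    ultimately have "(\<lambda>r. measure \<tau> (half_plane - K r)) \<longlonglongrightarrow> 0"
      by (simp only: measure_empty)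
    then have "\<forall>\<^sub>F r in sequentially. measure \<tau> (half_plane - K r) < d / 2"
      by (rule order_tendstoD) (use d in auto)
    moreover have "\<forall>\<^sub>F r in sequentially. dist (a r) a' < e"
      using \<open>a \<longlonglongrightarrow> a'\<close> e by (rule tendstoD)
    ultimately have "\<forall>\<^sub>F r in sequentially. measure \<tau> (half_plane - K r) < d / 2 \<and> dist (a r) a' < e"
      by (rule eventually_conj)
    then obtain r where r: "measure \<tau> (half_plane - K r) < d / 2" "dist (a r) a' < e"
      by (auto simp: eventually_sequentially)
    \<comment> \<open>The threshold is fixed at one: outside \<open>B n\<close> it only has to bound
      \<open>g n\<close> by \<open>c + 1\<close>. Closeness of \<open>g n\<close> to
      \<open>f\<close> enters through pointwise convergence in \<open>lim_D\<close>.\<close>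
    define B where "B n = {p. 1 < \<bar>g n p - f p\<bar>}" for n
    have B [measurable]: "B n \<in> sets borel" for n unfolding B_def by measurable
    have B_ev: "\<forall>\<^sub>F n in sequentially. p \<notin> B n" if "(\<lambda>n. g n p) \<longlonglongrightarrow> f p" for p
      using tendstoD[OF that zero_less_one] by eventually_elim (simp add: B_def dist_real_def)
    \<comment> \<open>Almost everywhere convergence yields convergence in measure because
      \<open>\<tau>\<close> is finite, so that the constant \<open>1\<close> is an integrable
      majorant.\<close>
    have "(\<lambda>n. \<integral>p. indicat_real (B n) p \<partial>\<tau>) \<longlonglongrightarrow> (\<integral>p. 0 \<partial>\<tau>)"
    proof (rule integral_dominated_convergence[where w = "\<lambda>_. 1"])
      show "AE p in \<tau>. (\<lambda>n. indicat_real (B n) p) \<longlonglongrightarrow> 0"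
        using AE_\<tau>[OF g_lim]
      proof eventually_elim
        case (elim p)
        show ?case by (rule tendsto_eventually, rule eventually_mono[OF B_ev[OF elim]]) simp
      qed
    qed (auto simp: indicator_def)
    then have "(\<lambda>n. measure \<tau> (B n)) \<longlonglongrightarrow> 0" by simp
    then have B_small: "\<forall>\<^sub>F n in sequentially. measure \<tau> (B n) < d / 2"
      by (rule order_tendstoD) (use d in auto)
    \<comment> \<open>The retained set moves with \<open>n\<close>, which is why
      \<open>small\<close> must be uniform in the index and the set simultaneously. Its complement
      in the half-plane is covered by two sets of \<open>\<tau>\<close>-measure below
      \<open>d / 2\<close>.\<close>
    define D where "D n = K r - B n" for n
    have D [measurable]: "D n \<in> sets borel" for n unfolding D_def by measurable
    have close: "\<forall>\<^sub>F n in sequentially. cmod (char (distr M borel (step_integral half_plane (g n))) u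
        - char (distr M borel (step_integral (D n) (g n))) u) \<le> (2 + \<bar>u\<bar>) * e"
      using B_small eventually_ge_at_top[of N]
    proof eventually_elim
      case (elim n)
      have "measure \<tau> (half_plane - D n) \<le> measure \<tau> ((half_plane - K r) \<union> B n)"
        by (rule \<tau>.finite_measure_mono) (auto simp: D_def sets_\<tau>)
      also have "\<dots> \<le> measure \<tau> (half_plane - K r) + measure \<tau> (B n)"
        by (rule measure_Un_le) (auto simp: sets_\<tau>)
      also have "\<dots> < d" using elim r by simp
      finally have le: "L0norm M (step_integral (half_plane - D n) (g n)) \<le> e"
        using elim by (intro small) auto
      have "D n \<union> (half_plane - D n) = half_plane" by (auto simp: D_def K_def)
      then have "AE \<omega> in M. step_integral half_plane (g n) \<omega> =
          step_integral (D n) (g n) \<omega> + step_integral (half_plane - D n) (g n) \<omega>"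
        using step_integral_Un[OF g, of "D n" "half_plane - D n" n] by simp
      then have "L0norm M (\<lambda>\<omega>. step_integral half_plane (g n) \<omega> - step_integral (D n) (g n) \<omega>)
          = L0norm M (step_integral (half_plane - D n) (g n))"
        by (intro L0norm_cong_AE) auto
      with le have le': "L0norm M (\<lambda>\<omega>. step_integral half_plane (g n) \<omega> - step_integral (D n) (g n) \<omega>) \<le> e"
        by simp
      show ?case
        by (rule order_trans[OF char_diff_le_L0norm mult_left_mono[OF le']]) auto
    qed
    have lim_D: "(\<lambda>n. char (distr M borel (step_integral (D n) (g n))) u) \<longlonglongrightarrow> a r"
    proof -
      obtain b where b: "\<And>v. \<bar>v\<bar> \<le> \<bar>u\<bar> * (c + 1) \<Longrightarrow> cmod (\<psi> v) \<le> b"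
        using \<psi>_bounded[of "\<bar>u\<bar> * (c + 1)"] by blast
      have "(\<lambda>n. CLINT p|\<rho>. indicat_real (D n) p *\<^sub>R \<psi> (u * g n p)) \<longlonglongrightarrow> (CLINT p|\<rho>. indicat_real (K r) p *\<^sub>R \<psi> (u * f p))"
      proof (rule integral_dominated_convergence[where w = "\<lambda>p. b * indicat_real (K r) p"])
        have "integrable \<rho> (indicat_real (K r))"
          using emeasure_\<rho>_bounded_borel[OF K] bounded_borel_sets[OF K]
          by (intro integrable_real_indicator) (simp_all only: sets_\<rho> infinity_ennreal_def)
        then show "integrable \<rho> (\<lambda>p. b * indicat_real (K r) p)" by simp
        show "AE p in \<rho>. (\<lambda>n. indicat_real (D n) p *\<^sub>R \<psi> (u * g n p)) \<longlonglongrightarrow> indicat_real (K r) p *\<^sub>R \<psi> (u * f p)"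
          using g_lim
        proof eventually_elim
          case (elim p)
          have "\<forall>\<^sub>F n in sequentially. indicat_real (K r) p *\<^sub>R \<psi> (u * g n p) = indicat_real (D n) p *\<^sub>R \<psi> (u * g n p)"
            using B_ev[OF elim] by eventually_elim (simp add: D_def indicator_def)
          moreover have "(\<lambda>n. indicat_real (K r) p *\<^sub>R \<psi> (u * g n p)) \<longlonglongrightarrow> indicat_real (K r) p *\<^sub>R \<psi> (u * f p)"
            by (intro tendsto_scaleR tendsto_const \<psi>_tendsto tendsto_mult elim)
          ultimately show ?case by (rule Lim_transform_eventually[rotated])
        qed
        show "AE p in \<rho>. norm (indicat_real (D n) p *\<^sub>R \<psi> (u * g n p)) \<le> b * indicat_real (K r) p" for n
        proof (rule AE_I2)
          fix p
          show "norm (indicat_real (D n) p *\<^sub>R \<psi> (u * g n p)) \<le> b * indicat_real (K r) p"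
          proof (cases "p \<in> D n")
            case True
            then have "\<bar>g n p\<bar> \<le> c + 1"
              using f_bound[of p] by (auto simp: D_def B_def)
            then have "cmod (\<psi> (u * g n p)) \<le> b"
              by (intro b) (simp add: abs_mult mult_left_mono)
            with True show ?thesis by (simp add: D_def)
          next
            case False
            have "0 \<le> b" using b[of 0] f_bound[of p] by simp
            with False show ?thesis by simp
          qed
        qed
      qed measurable
      then show ?thesis
        unfolding char_step_integral[OF g D] a_def by (rule tendsto_exp)
    qed
    have lim_Y: "(\<lambda>n. char (distr M borel (step_integral half_plane (g n))) u) \<longlonglongrightarrow> char (distr M borel Y) u"
    proof (rule LIM_zero_cancel, rule tendsto_norm_zero_cancel)
      have "(\<lambda>n. (2 + \<bar>u\<bar>) * L0norm M (\<lambda>\<omega>. step_integral half_plane (g n) \<omega> - Y \<omega>)) \<longlonglongrightarrow> (2 + \<bar>u\<bar>) * 0"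
        by (intro tendsto_mult tendsto_const tendsto_in_prob_L0norm g_Y) auto
      then have *: "(\<lambda>n. (2 + \<bar>u\<bar>) * L0norm M (\<lambda>\<omega>. step_integral half_plane (g n) \<omega> - Y \<omega>)) \<longlonglongrightarrow> 0"
        by simp
      show "(\<lambda>n. cmod (char (distr M borel (step_integral half_plane (g n))) u - char (distr M borel Y) u)) \<longlonglongrightarrow> 0"
        by (rule tendsto_sandwich[OF _ _ tendsto_const *]; intro always_eventually allI char_diff_le_L0norm) auto
    qed
    have "cmod (char (distr M borel Y) u - a r) \<le> (2 + \<bar>u\<bar>) * e"
      by (rule tendsto_upperbound[OF tendsto_norm[OF tendsto_diff[OF lim_Y lim_D]] close]) simp
    moreover have "cmod (a r - a') < e" using r(2) by (simp add: dist_norm)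
    ultimately have "cmod (char (distr M borel Y) u - a') \<le> (2 + \<bar>u\<bar>) * e + e"
      using norm_triangle_ineq[of "char (distr M borel Y) u - a r" "a r - a'"] by simp
    then show ?thesis by (simp add: algebra_simps)
  qed
  have "cmod (char (distr M borel Y) u - a') \<le> 0 + e" if "0 < e" for e
  proof -
    have u: "0 < 3 + \<bar>u\<bar>" by simp
    have "cmod (char (distr M borel Y) u - a') \<le> (3 + \<bar>u\<bar>) * (e / (3 + \<bar>u\<bar>))"
      by (rule bound[OF divide_pos_pos[OF that u]])
    then show ?thesis using u by simp
  qed
  then have "cmod (char (distr M borel Y) u - a') \<le> 0"
    by (rule field_le_epsilon)
  then show ?thesis by (simp add: a'_def)
qed

section \<open>First and second moments of integrals and of the supOU process\<close>

lemma \<psi>_second_order: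
  assumes Y: "has_levy_integral M \<Lambda> \<pi> (indicator ({..<0} \<times> {0<..1})) Y"
    and Y2: "integrable M (\<lambda>\<omega>. (Y \<omega>)\<^sup>2)"
  shows "((\<lambda>u. (\<psi> u - \<i> * u * expectation Y) / (of_real u)\<^sup>2) \<longlongrightarrow> - of_real (variance Y) / 2) (at 0)"
proof -
  have Ym: "Y \<in> borel_measurable M" using Y by (simp add: has_levy_integral_def)
  let ?S = "{..<0} \<times> {0<..1} :: (real \<times> real) set"
  have S: "?S \<in> sets \<rho>" by (intro pair_measureI) auto
  \<comment> \<open>The strip has mass one, as \<open>\<pi>\<close> is carried by the negative reals
    and the time interval has length one. Hence the characteristic function of \<open>Y\<close> is
    exactly the exponential of \<open>\<psi>\<close>.\<close>
  have "emeasure \<rho> ?S = emeasure \<pi> {..<0} * emeasure lborel {0<..1 :: real}"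
    by (intro lborel.emeasure_pair_measure_Times) auto
  also have "emeasure \<pi> {..<0} = 1"
    using quadruple by (intro \<pi>.emeasure_eq_1_AE) (auto simp: has_generating_quadruple_def)
  finally have emS: "emeasure \<rho> ?S = 1" by simp
  have eq: "(\<lambda>p. \<psi> (u * indicator ?S p)) = (\<lambda>p. indicat_real ?S p *\<^sub>R \<psi> u)" for u
    by (auto simp: indicator_def)
  have "integrable \<rho> (indicat_real ?S)"
    using S emS by (intro integrable_real_indicator) auto
  then have int: "integrable \<rho> (\<lambda>p. \<psi> (u * indicator ?S p))"
    and val: "(CLINT p|\<rho>. \<psi> (u * indicator ?S p)) = \<psi> u" for u
    unfolding eq using emS by (auto simp: measure_def)
  have char: "char (distr M borel Y) u = exp (\<psi> u)" for u
    using char_levy_integral[OF Y _ int, of 1] unfolding val by (simp add: indicator_def)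
  \<comment> \<open>Continuity together with \<open>\<psi> 0 = 0\<close> singles out
    \<open>\<psi>\<close> as the logarithm that is small near the origin.\<close>
  have "((\<lambda>u. \<psi> u) \<longlongrightarrow> \<psi> 0) (at 0)" by (intro \<psi>_tendsto tendsto_ident_at)
  then have "((\<lambda>u. (\<psi> u - \<i> * u * expectation Y) / (of_real u)\<^sup>2) \<longlongrightarrow>
      - of_real (expectation (\<lambda>\<omega>. (Y \<omega>)\<^sup>2) - (expectation Y)\<^sup>2) / 2) (at 0)"
    using char_second_order[OF Ym Y2] unfolding char by (intro log_second_order) auto
  moreover have "variance Y = expectation (\<lambda>\<omega>. (Y \<omega>)\<^sup>2) - (expectation Y)\<^sup>2"
    by (rule variance_eq[OF square_integrable_imp_integrable[OF Ym Y2] Y2])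
  ultimately show ?thesis by simp
qed

text \<open>The second order quotient \<open>R\<close> of \<open>\<psi>\<close> is continuous, hence
  bounded on the range of \<open>u * f p\<close> for bounded \<open>u\<close>. A multiple of the
  square of \<open>f\<close> then dominates the remainder, and the expansion of
  \<open>\<psi>\<close> integrates term by term to one of the logarithm of the characteristic
  function of \<open>Y\<close>.\<close>

lemma levy_integral_moments:
  fixes \<mu> v :: real
  assumes \<psi>_lim: "((\<lambda>u. (\<psi> u - \<i> * u * \<mu>) / (of_real u)\<^sup>2) \<longlongrightarrow> - of_real v / 2) (at 0)"
    and Y: "has_levy_integral M \<Lambda> \<pi> f Y" and f_bound: "\<And>p. \<bar>f p\<bar> \<le> c"
    and f1: "integrable \<rho> f" and f2: "integrable \<rho> (\<lambda>p. (f p)\<^sup>2)"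
    and Y2: "integrable M (\<lambda>\<omega>. (Y \<omega>)\<^sup>2)"
  shows "expectation Y = \<mu> * (\<integral>p. f p \<partial>\<rho>)"
    and "expectation (\<lambda>\<omega>. (Y \<omega>)\<^sup>2) = v * (\<integral>p. (f p)\<^sup>2 \<partial>\<rho>) + (\<mu> * (\<integral>p. f p \<partial>\<rho>))\<^sup>2"
proof -
  \<comment> \<open>The value at \<open>0\<close> is the limit assumed in \<open>\<psi>_lim\<close>,
    so that \<open>R\<close> is continuous everywhere.\<close>
  define R where "R x = (if x = 0 then - of_real v / 2 else (\<psi> x - \<i> * x * \<mu>) / (of_real x)\<^sup>2)" for x :: real
  have \<psi>_R: "\<psi> x = \<i> * x * \<mu> + (of_real x)\<^sup>2 * R x" for x
    by (simp add: R_def)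
  have "isCont R x" for x
  proof (cases "x = 0")
    case True
    have "(R \<longlongrightarrow> - of_real v / 2) (at 0)"
      by (rule filterlim_cong[THEN iffD1, OF refl refl _ \<psi>_lim]) (simp add: R_def eventually_at_filter)
    then show ?thesis unfolding True isCont_def by (simp add: R_def)
  next
    case False
    have "isCont (\<lambda>x. (\<psi> x - \<i> * x * \<mu>) / (of_real x)\<^sup>2) x"
      using False \<psi>_tendsto[OF tendsto_ident_at, of x UNIV] by (intro continuous_intros) (auto simp: isCont_def)
    moreover have "\<forall>\<^sub>F y in nhds x. R y = (\<psi> y - \<i> * y * \<mu>) / (of_real y)\<^sup>2"
      using t1_space_nhds[OF False] by eventually_elim (simp add: R_def)
    ultimately show ?thesis by (subst isCont_cong) auto
  qed
  then have R_cont: "continuous_on UNIV R" by (simp add: continuous_at_imp_continuous_on)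
  then have [measurable]: "R \<in> borel_measurable borel" by (rule borel_measurable_continuous_onI)
  have [measurable]: "f \<in> borel_measurable borel" and Ym: "Y \<in> borel_measurable M"
    using Y by (auto simp: has_levy_integral_def)
  have c0: "0 \<le> c" using f_bound[of undefined] by simp
  have "\<exists>K. \<forall>x. \<bar>x\<bar> \<le> r \<longrightarrow> cmod (R x) \<le> K" for r
  proof -
    have "compact (R ` {-r..r})"
      by (rule compact_continuous_image[OF continuous_on_subset[OF R_cont]]) auto
    then obtain K where "\<forall>z\<in>R ` {-r..r}. cmod z \<le> K"
      using compact_imp_bounded bounded_iff by metis
    then show ?thesis by (intro exI[of _ K]) (auto simp: abs_le_iff)
  qed
  then obtain K where K: "\<And>r x. \<bar>x\<bar> \<le> r \<Longrightarrow> cmod (R x) \<le> K r" by metis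
  have K_f: "cmod (R (u * f p)) \<le> K (\<bar>u\<bar> * c)" for u p
    by (rule K) (simp add: abs_mult f_bound mult_left_mono)
  have int_R: "integrable \<rho> (\<lambda>p. (of_real (f p))\<^sup>2 * R (u * f p))" for u
  proof (rule Bochner_Integration.integrable_bound[where f = "\<lambda>p. K (\<bar>u\<bar> * c) * (f p)\<^sup>2"])
    show "AE p in \<rho>. norm ((of_real (f p))\<^sup>2 * R (u * f p)) \<le> norm (K (\<bar>u\<bar> * c) * (f p)\<^sup>2)"
      using K_f by (intro AE_I2) (auto simp: norm_mult norm_power abs_mult power2_abs mult.commute[of "(f _)\<^sup>2"] intro!: mult_right_mono order_trans[OF K_f abs_ge_self])
  qed (use f2 in auto)
  have \<psi>_f: "\<psi> (u * f p) = (\<i> * u * \<mu>) * of_real (f p) + (of_real u)\<^sup>2 * ((of_real (f p))\<^sup>2 * R (u * f p))" for u p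
    by (subst \<psi>_R) (simp add: power_mult_distrib algebra_simps)
  have int: "integrable \<rho> (\<lambda>p. \<psi> (u * f p))" for u
    unfolding \<psi>_f using f1 int_R[of u]
    by (intro Bochner_Integration.integrable_add integrable_mult_right) auto
  define w where "w u = (CLINT p|\<rho>. \<psi> (u * f p))" for u
  have w_eq: "w u = \<i> * u * \<mu> * of_real (\<integral>p. f p \<partial>\<rho>) + (of_real u)\<^sup>2 * (CLINT p|\<rho>. (of_real (f p))\<^sup>2 * R (u * f p))" for u
    unfolding w_def \<psi>_f using f1 int_R[of u]
    by (subst Bochner_Integration.integral_add) (auto intro!: integrable_mult_right)
  have "((\<lambda>u. CLINT p|\<rho>. (of_real (f p))\<^sup>2 * R (u * f p)) \<longlongrightarrow> (CLINT p|\<rho>. (of_real (f p))\<^sup>2 * R 0)) (at 0)"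
    unfolding tendsto_at_iff_sequentially
  proof (intro allI impI)
    fix x :: "nat \<Rightarrow> real" assume "\<forall>i. x i \<in> UNIV - {0}" and x: "x \<longlonglongrightarrow> 0"
    obtain b where b: "\<And>i. \<bar>x i\<bar> \<le> b"
      using convergent_imp_Bseq[OF convergentI[OF x]] by (auto simp: Bseq_def)
    show "((\<lambda>u. CLINT p|\<rho>. (of_real (f p))\<^sup>2 * R (u * f p)) \<circ> x) \<longlonglongrightarrow> (CLINT p|\<rho>. (of_real (f p))\<^sup>2 * R 0)"
      unfolding comp_def
    proof (rule integral_dominated_convergence[where w = "\<lambda>p. K (b * c) * (f p)\<^sup>2"])
      show "AE p in \<rho>. (\<lambda>i. (of_real (f p))\<^sup>2 * R (x i * f p)) \<longlonglongrightarrow> (of_real (f p))\<^sup>2 * R 0"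
      proof (rule AE_I2)
        fix p
        have "(\<lambda>i. x i * f p) \<longlonglongrightarrow> 0 * f p" by (intro tendsto_intros x)
        then have "(\<lambda>i. R (x i * f p)) \<longlonglongrightarrow> R 0"
          by (intro isCont_tendsto_compose[OF \<open>isCont R 0\<close>]) simp
        then show "(\<lambda>i. (of_real (f p))\<^sup>2 * R (x i * f p)) \<longlonglongrightarrow> (of_real (f p))\<^sup>2 * R 0"
          by (intro tendsto_mult tendsto_const)
      qed
      show "AE p in \<rho>. norm ((of_real (f p))\<^sup>2 * R (x i * f p)) \<le> K (b * c) * (f p)\<^sup>2" for i
      proof (rule AE_I2)
        fix p
        have "cmod (R (x i * f p)) \<le> K (b * c)"
          by (rule K) (simp add: abs_mult b f_bound mult_mono' )
        then show "norm ((of_real (f p))\<^sup>2 * R (x i * f p)) \<le> K (b * c) * (f p)\<^sup>2"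
          by (simp add: norm_mult norm_power mult.commute[of "(f p)\<^sup>2"] mult_right_mono)
      qed
    qed (use f2 in auto)
  qed
  moreover have "(CLINT p|\<rho>. (of_real (f p))\<^sup>2 * R 0) = - of_real (v * (\<integral>p. (f p)\<^sup>2 \<partial>\<rho>)) / 2"
    by (simp add: R_def of_real_power[symmetric] del: of_real_power)
  moreover have "\<forall>\<^sub>F u in at 0. (CLINT p|\<rho>. (of_real (f p))\<^sup>2 * R (u * f p)) =
      (w u - \<i> * u * of_real (\<mu> * (\<integral>p. f p \<partial>\<rho>))) / (of_real u)\<^sup>2"
    unfolding w_eq by (simp add: eventually_at_filter)
  ultimately have lim: "((\<lambda>u. (w u - \<i> * u * of_real (\<mu> * (\<integral>p. f p \<partial>\<rho>))) / (of_real u)\<^sup>2)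
      \<longlongrightarrow> - of_real (v * (\<integral>p. (f p)\<^sup>2 \<partial>\<rho>)) / 2) (at 0)"
    by (auto intro: Lim_transform_eventually)
  have "char (distr M borel Y) u = exp (w u)" for u
    unfolding w_def by (rule char_levy_integral[OF Y f_bound int])
  then have "\<forall>\<^sub>F u in at 0. char (distr M borel Y) u = exp (w u)" by simp
  from moments_of_log_char[OF Ym Y2 this lim]
  show "expectation Y = \<mu> * (\<integral>p. f p \<partial>\<rho>)"
    and "expectation (\<lambda>\<omega>. (Y \<omega>)\<^sup>2) = v * (\<integral>p. (f p)\<^sup>2 \<partial>\<rho>) + (\<mu> * (\<integral>p. f p \<partial>\<rho>))\<^sup>2" by auto
qed

lemma supOU_moments:
  fixes \<mu> v \<alpha> B h t :: real
  assumes \<psi>_lim: "((\<lambda>u. (\<psi> u - \<i> * u * \<mu>) / (of_real u)\<^sup>2) \<longlongrightarrow> - of_real v / 2) (at 0)"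
    and \<pi>: "\<pi> = mean_reversion_law \<alpha> B" and params: "1 < \<alpha>" "B < 0"
    and X: "\<And>t. has_levy_integral M \<Lambda> \<pi> (supOU_kernel t) (X t)"
    and X2: "\<And>t. integrable M (\<lambda>\<omega>. (X t \<omega>)\<^sup>2)"
    and h: "0 \<le> h"
  shows "expectation (X t) = - (\<mu> / (B * (\<alpha> - 1)))"
    and "expectation (\<lambda>\<omega>. (X t \<omega>)\<^sup>2) = (\<mu> / (B * (\<alpha> - 1)))\<^sup>2 - v / (2 * B * (\<alpha> - 1))"
    and "integrable M (\<lambda>\<omega>. X t \<omega> * X (t + h) \<omega>)"
    and "expectation (\<lambda>\<omega>. X t \<omega> * X (t + h) \<omega>) =
      (\<mu> / (B * (\<alpha> - 1)))\<^sup>2 - v * (1 - B * h) powr (1 - \<alpha>) / (2 * B * (\<alpha> - 1))"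
proof -
  let ?k = supOU_kernel
  have k1: "has_bochner_integral \<rho> (?k s) (- (1 / (B * (\<alpha> - 1))))" for s
    using has_bochner_integral_supOU_kernel[of \<alpha> B 1 0 s] params
    by (simp add: \<pi> supOU_kernel_def case_prod_beta' cong: if_cong)
  have k2: "has_bochner_integral \<rho> (\<lambda>p. ?k s p * ?k (s + h) p) (- ((1 - B * h) powr (1 - \<alpha>) / (2 * B * (\<alpha> - 1))))"
    if "0 \<le> h" for s h
  proof -
    \<comment> \<open>For a nonnegative lag the earlier kernel has the smaller support, and the
      exponents \<open>A * (s - r)\<close> and \<open>A * (s + h - r)\<close> add up to the form
      with \<open>c = 2\<close>.\<close>
    have "(\<lambda>p. ?k s p * ?k (s + h) p) =
        (\<lambda>p. if fst p < 0 \<and> snd p \<le> s then exp (fst p * (2 * (s - snd p) + h)) else 0)"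
      using that by (auto simp: supOU_kernel_def fun_eq_iff exp_add[symmetric] algebra_simps)
    then show ?thesis
      using has_bochner_integral_supOU_kernel[OF params, of 2 h s] that by (simp add: \<pi>)
  qed
  have sq: "has_bochner_integral \<rho> (\<lambda>p. (?k s p)\<^sup>2) (- (1 / (2 * B * (\<alpha> - 1))))" for s
    using k2[of 0 s] by (simp add: power2_eq_square)
  have bound: "\<bar>?k s p\<bar> \<le> 1" for s p
    by (auto simp: supOU_kernel_def mult_nonpos_nonneg split: prod.split)
  have one: "expectation (X s) = - (\<mu> / (B * (\<alpha> - 1)))"
    "expectation (\<lambda>\<omega>. (X s \<omega>)\<^sup>2) = (\<mu> / (B * (\<alpha> - 1)))\<^sup>2 - v / (2 * B * (\<alpha> - 1))" for s
    using levy_integral_moments[OF \<psi>_lim X bound _ _ X2, of s] k1[of s] sq[of s]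
    by (auto simp: has_bochner_integral_iff)
  show "expectation (X t) = - (\<mu> / (B * (\<alpha> - 1)))"
    "expectation (\<lambda>\<omega>. (X t \<omega>)\<^sup>2) = (\<mu> / (B * (\<alpha> - 1)))\<^sup>2 - v / (2 * B * (\<alpha> - 1))"
    by (rule one)+
  have [measurable]: "X s \<in> borel_measurable M" for s
    using X[of s] by (simp add: has_levy_integral_def)
  show int: "integrable M (\<lambda>\<omega>. X t \<omega> * X (t + h) \<omega>)"
  proof (rule Bochner_Integration.integrable_bound[where f = "\<lambda>\<omega>. (X t \<omega>)\<^sup>2 + (X (t + h) \<omega>)\<^sup>2"])
    have "\<bar>x * y\<bar> \<le> x\<^sup>2 + y\<^sup>2" for x y :: real
    proof -
      have "2 * \<bar>x * y\<bar> \<le> x\<^sup>2 + y\<^sup>2"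
        using sum_squares_bound[of "\<bar>x\<bar>" "\<bar>y\<bar>"] by (simp add: abs_mult)
      then show ?thesis using abs_ge_zero[of "x * y"] by linarith
    qed
    then show "AE \<omega> in M. norm (X t \<omega> * X (t + h) \<omega>) \<le> norm ((X t \<omega>)\<^sup>2 + (X (t + h) \<omega>)\<^sup>2)" by simp
  qed (use X2 in auto)
  have expand: "(x + y)\<^sup>2 = x\<^sup>2 + 2 * (x * y) + y\<^sup>2" for x y :: real
    by (simp add: power2_sum)
  \<comment> \<open>Here \<open>a\<close> is the squared mean, \<open>- b\<close> the variance and
    \<open>- d\<close> the autocovariance at lag \<open>h\<close>, the signs coming from
    \<open>B < 0\<close>. The unknown \<open>e\<close> is the mixed moment and \<open>y\<close> the
    second moment of the sum.\<close>
  have solve: "e = a - d" if "y = 2 * (- b - d) + 4 * a" "y = a - b + 2 * e + (a - b)" for a b d e y :: real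
    using that by (simp add: algebra_simps)
  \<comment> \<open>The mixed moment is obtained from the square of \<open>X t + X (t + h)\<close>, again an integral.\<close>
  let ?Y = "\<lambda>\<omega>. X t \<omega> + X (t + h) \<omega>" and ?f = "\<lambda>p. ?k t p + ?k (t + h) p"
  have f1: "has_bochner_integral \<rho> ?f (- (1 / (B * (\<alpha> - 1))) + - (1 / (B * (\<alpha> - 1))))"
    by (intro has_bochner_integral_add k1)
  have f2: "has_bochner_integral \<rho> (\<lambda>p. (?f p)\<^sup>2)
      (- (1 / (2 * B * (\<alpha> - 1))) + 2 * - ((1 - B * h) powr (1 - \<alpha>) / (2 * B * (\<alpha> - 1))) + - (1 / (2 * B * (\<alpha> - 1))))"
    unfolding expand by (intro has_bochner_integral_add has_bochner_integral_mult_right sq k2 h)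
  have Y2: "integrable M (\<lambda>\<omega>. (?Y \<omega>)\<^sup>2)"
    unfolding expand by (intro Bochner_Integration.integrable_add integrable_mult_right X2 int)
  have "expectation (\<lambda>\<omega>. (?Y \<omega>)\<^sup>2) = v * (\<integral>p. (?f p)\<^sup>2 \<partial>\<rho>) + (\<mu> * (\<integral>p. ?f p \<partial>\<rho>))\<^sup>2"
  proof (rule levy_integral_moments(2)[OF \<psi>_lim has_levy_integral_add[OF X X] _ _ _ Y2])
    show "\<bar>?f p\<bar> \<le> 2" for p
      using abs_triangle_ineq[of "?k t p" "?k (t + h) p"] bound[of t p] bound[of "t + h" p] by linarith
  qed (use f1 f2 in \<open>auto simp: has_bochner_integral_iff\<close>)
  also have "\<dots> = v * (- (1 / (2 * B * (\<alpha> - 1))) + 2 * - ((1 - B * h) powr (1 - \<alpha>) / (2 * B * (\<alpha> - 1))) + - (1 / (2 * B * (\<alpha> - 1))))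
      + (\<mu> * (- (1 / (B * (\<alpha> - 1))) + - (1 / (B * (\<alpha> - 1)))))\<^sup>2"
    using has_bochner_integral_integral_eq[OF f1] has_bochner_integral_integral_eq[OF f2] by (simp only:)
  also have "\<dots> = 2 * (- (v / (2 * B * (\<alpha> - 1))) - v * (1 - B * h) powr (1 - \<alpha>) / (2 * B * (\<alpha> - 1)))
      + 4 * (\<mu> / (B * (\<alpha> - 1)))\<^sup>2"
    by (simp add: power2_eq_square algebra_simps)
  finally have "expectation (\<lambda>\<omega>. (?Y \<omega>)\<^sup>2) = \<dots>" .
  moreover have "expectation (\<lambda>\<omega>. (?Y \<omega>)\<^sup>2) = expectation (\<lambda>\<omega>. (X t \<omega>)\<^sup>2)
      + 2 * expectation (\<lambda>\<omega>. X t \<omega> * X (t + h) \<omega>) + expectation (\<lambda>\<omega>. (X (t + h) \<omega>)\<^sup>2)"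
    unfolding expand using X2 int by simp
  ultimately show "expectation (\<lambda>\<omega>. X t \<omega> * X (t + h) \<omega>) =
      (\<mu> / (B * (\<alpha> - 1)))\<^sup>2 - v * (1 - B * h) powr (1 - \<alpha>) / (2 * B * (\<alpha> - 1))"
    unfolding one by (rule solve)
qed

end

section \<open>Identifiability\<close>

text \<open>The derivative of the quotient of logarithms has the sign given by \<open>key\<close>.
  The conclusion is cross-multiplied to match the equations obtained from two lags.\<close>

lemma ln_quotient_strict_antimono:
  fixes b c :: real
  assumes "0 < b" "b < c"
  shows "ln (1 + 2 * c) * ln (1 + b) < ln (1 + 2 * b) * ln (1 + c)"
proof -
  have key: "(2 + 2 * x) * ln (1 + x) < (1 + 2 * x) * ln (1 + 2 * x)" if "0 < x" for x :: real
  proof -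
    \<comment> \<open>The difference of the two sides of \<open>key\<close> vanishes at
      \<open>0\<close>, and the constants in its derivative cancel, leaving
      \<open>2 * (ln (1 + 2 * y) - ln (1 + y))\<close>, which is positive.\<close>
    define h where "h = (\<lambda>x :: real. (1 + 2 * x) * ln (1 + 2 * x) - (2 + 2 * x) * ln (1 + x))"
    have "h 0 < h x"
    proof (rule DERIV_pos_imp_increasing_open[OF that])
      fix y :: real assume y: "0 < y" "y < x"
      have "(h has_real_derivative 2 * (ln (1 + 2 * y) - ln (1 + y))) (at y)"
        unfolding h_def using y
        by (auto intro!: derivative_eq_intros simp: divide_simps) (simp add: algebra_simps)
      moreover have "ln (1 + y) < ln (1 + 2 * y)" using y by simp
      ultimately show "\<exists>z. (h has_real_derivative z) (at y) \<and> 0 < z"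
        by (intro exI[of _ "2 * (ln (1 + 2 * y) - ln (1 + y))"]) auto
    qed (auto simp: h_def intro!: continuous_intros)
    then show ?thesis by (simp add: h_def)
  qed
  define q where "q = (\<lambda>x :: real. ln (1 + 2 * x) / ln (1 + x))"
  have "q c < q b"
  proof (rule DERIV_neg_imp_decreasing[OF assms(2)])
    fix x assume x: "b \<le> x" "x \<le> c"
    then have x0: "0 < x" using assms by simp
    define z where "z = (2 / (1 + 2 * x) * ln (1 + x) - ln (1 + 2 * x) * (1 / (1 + x))) / (ln (1 + x) * ln (1 + x))"
    have "(q has_real_derivative z) (at x)"
      unfolding q_def z_def using x0 by (auto intro!: derivative_eq_intros simp: field_simps)
    moreover have "z < 0"
    proof -
      have "2 / (1 + 2 * x) * ln (1 + x) - ln (1 + 2 * x) * (1 / (1 + x)) =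
          ((2 + 2 * x) * ln (1 + x) - (1 + 2 * x) * ln (1 + 2 * x)) / ((1 + 2 * x) * (1 + x))"
        using x0 by (simp add: divide_simps)
      also have "\<dots> < 0"
        using key[OF x0] x0 by (intro divide_neg_pos mult_pos_pos) auto
      finally show ?thesis
        unfolding z_def using x0 by (intro divide_neg_pos) auto
    qed
    ultimately show "\<exists>y. (q has_real_derivative y) (at x) \<and> y < 0" by blast
  qed
  then show ?thesis using assms by (simp add: q_def field_simps)
qed

text \<open>Logarithms make both equations linear in \<open>1 - \<alpha>\<close> and
  \<open>1 - \<alpha>'\<close>. Cross-multiplying them eliminates these nonzero factors, and strict
  monotonicity of the quotient leaves only \<open>B = B'\<close>.\<close>

lemma powr_lags_identify:
  fixes \<alpha> \<alpha>' B B' :: real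
  assumes "1 < \<alpha>" "1 < \<alpha>'" "B < 0" "B' < 0"
    and lag1: "(1 - B) powr (1 - \<alpha>) = (1 - B') powr (1 - \<alpha>')"
    and lag2: "(1 - B * 2) powr (1 - \<alpha>) = (1 - B' * 2) powr (1 - \<alpha>')"
  shows "\<alpha> = \<alpha>'" "B = B'"
proof -
  have e1: "(1 - \<alpha>) * ln (1 + - B) = (1 - \<alpha>') * ln (1 + - B')"
    using arg_cong[OF lag1, of ln] assms(3,4) by (simp only: ln_powr) simp
  have e2: "(1 - \<alpha>) * ln (1 + 2 * (- B)) = (1 - \<alpha>') * ln (1 + 2 * (- B'))"
    using arg_cong[OF lag2, of ln] assms(3,4) by (simp only: ln_powr) (simp add: mult.commute)
  have "((1 - \<alpha>) * ln (1 + 2 * (- B))) * ((1 - \<alpha>') * ln (1 + - B'))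
      = ((1 - \<alpha>') * ln (1 + 2 * (- B'))) * ((1 - \<alpha>) * ln (1 + - B))"
    by (simp only: e1 e2)
  then have "(1 - \<alpha>) * (1 - \<alpha>') * (ln (1 + 2 * (- B)) * ln (1 + - B'))
      = (1 - \<alpha>) * (1 - \<alpha>') * (ln (1 + 2 * (- B')) * ln (1 + - B))"
    by (simp only: mult_ac)
  then have "ln (1 + 2 * (- B)) * ln (1 + - B') = ln (1 + 2 * (- B')) * ln (1 + - B)"
    using assms by simp
  then show B: "B = B'"
    using ln_quotient_strict_antimono[of "- B" "- B'"] ln_quotient_strict_antimono[of "- B'" "- B"] assms
    by (cases B B' rule: linorder_cases) auto
  have "ln (1 + - B) \<noteq> 0" using assms by simp
  then show "\<alpha> = \<alpha>'" using e1 B by simp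
qed

text \<open>Dividing the autocovariance by the variance, nonzero because \<open>0 < v\<close>,
  leaves the autocorrelation \<open>(1 - B * h) powr (1 - \<alpha>)\<close>, which is free of
  \<open>v\<close>. Once \<open>\<alpha>\<close> and \<open>B\<close> agree, \<open>\<mu>\<close>
  and \<open>v\<close> follow by cancelling a common denominator.\<close>

lemma moment_equations_identify:
  fixes \<mu> v \<alpha> B \<mu>' v' \<alpha>' B' :: real
  assumes "1 < \<alpha>" "B < 0" "0 < v" "1 < \<alpha>'" "B' < 0" "0 < v'"
    and mean: "\<mu> / (B * (\<alpha> - 1)) = \<mu>' / (B' * (\<alpha>' - 1))"
    and var: "v / (2 * B * (\<alpha> - 1)) = v' / (2 * B' * (\<alpha>' - 1))"
    and cov: "\<And>h. h \<in> {1, 2} \<Longrightarrow> v * (1 - B * h) powr (1 - \<alpha>) / (2 * B * (\<alpha> - 1)) =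
      v' * (1 - B' * h) powr (1 - \<alpha>') / (2 * B' * (\<alpha>' - 1))"
  shows "(\<mu>, v, \<alpha>, B) = (\<mu>', v', \<alpha>', B')"
proof -
  have "(1 - B * h) powr (1 - \<alpha>) = (1 - B' * h) powr (1 - \<alpha>')" if "h \<in> {1, 2}" for h
  proof -
    have "v / (2 * B * (\<alpha> - 1)) * (1 - B * h) powr (1 - \<alpha>) = v / (2 * B * (\<alpha> - 1)) * (1 - B' * h) powr (1 - \<alpha>')"
      using cov[OF that] unfolding var[symmetric] by (metis times_divide_eq_left var)
    then show ?thesis using assms by simp
  qed
  from this[of 1] this[of 2] have "\<alpha> = \<alpha>'" "B = B'"
    using powr_lags_identify[of \<alpha> \<alpha>' B B'] assms by auto
  then show ?thesis using assms by simp
qed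

theorem proposition3p2:
  fixes W :: "params set" and \<beta>\<^sub>0 :: params
    and M :: "'a measure" and \<Lambda> :: "(real \<times> real) set \<Rightarrow> 'a \<Rightarrow> real"
    and \<gamma> \<Sigma> :: real and \<nu> \<pi> :: "real measure"
    and L X :: "real \<Rightarrow> 'a \<Rightarrow> real" and m :: nat
  assumes "compact W"
    and "W \<subseteq> {(\<mu>, v, \<alpha>, B). 0 < v \<and> 1 < \<alpha> \<and> B < 0}"
    and "\<beta>\<^sub>0 \<in> W"
    and "supOU_process M \<Lambda> \<gamma> \<Sigma> \<nu> \<pi> X"
    and "stationary_process M X"
    and "\<And>t. integrable M (\<lambda>\<omega>. (X t \<omega>)\<^sup>2)"
    and "underlying_levy_process M \<Lambda> \<pi> L"
    and "true_params M \<pi> L \<beta>\<^sub>0"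
    and "2 \<le> m"
  shows "\<forall>t. \<forall>\<beta>\<in>W.
    (\<forall>i<m + 2. has_bochner_integral M (\<lambda>\<omega>. f_X m (window X m t \<omega>) \<beta> ! i) 0) \<longleftrightarrow> \<beta> = \<beta>\<^sub>0"
proof (intro allI ballI)
  fix t \<beta> assume "\<beta> \<in> W"
  obtain \<mu> v \<alpha> B where \<beta>: "\<beta> = (\<mu>, v, \<alpha>, B)" by (cases \<beta>)
  obtain \<mu>\<^sub>0 v\<^sub>0 \<alpha>\<^sub>0 B\<^sub>0 where \<beta>\<^sub>0: "\<beta>\<^sub>0 = (\<mu>\<^sub>0, v\<^sub>0, \<alpha>\<^sub>0, B\<^sub>0)" by (cases \<beta>\<^sub>0)
  have \<beta>_pos: "1 < \<alpha>" "B < 0" "0 < v" and \<beta>\<^sub>0_pos: "1 < \<alpha>\<^sub>0" "B\<^sub>0 < 0" "0 < v\<^sub>0"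
    using assms(2,3) \<open>\<beta> \<in> W\<close> by (auto simp: \<beta> \<beta>\<^sub>0)
  have L: "integrable M (\<lambda>\<omega>. (L 1 \<omega>)\<^sup>2)" "prob_space.expectation M (L 1) = \<mu>\<^sub>0"
      "prob_space.variance M (L 1) = v\<^sub>0" "\<pi> = mean_reversion_law \<alpha>\<^sub>0 B\<^sub>0"
    using assms(8) by (auto simp: true_params_def \<beta>\<^sub>0)
  have X: "\<And>t. has_levy_integral M \<Lambda> \<pi> (supOU_kernel t) (X t)"
    using assms(4) by (simp add: supOU_process_def)
  interpret levy_basis_quadruple M \<Lambda> \<gamma> \<Sigma> \<nu> \<pi>
    using assms(4) by unfold_locales (auto simp: supOU_process_def)
  have "((\<lambda>u. (\<psi> u - \<i> * u * \<mu>\<^sub>0) / (of_real u)\<^sup>2) \<longlongrightarrow> - of_real v\<^sub>0 / 2) (at 0)"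
    using \<psi>_second_order[of "L 1"] assms(7) L(1-3) by (simp add: underlying_levy_process_def)
  note moments = supOU_moments[OF this L(4) \<beta>\<^sub>0_pos(1,2) X assms(6)]
  have X_meas [measurable]: "X s \<in> borel_measurable M" for s
    using X[of s] by (simp add: has_levy_integral_def)
  have X1: "integrable M (X t)"
    by (rule square_integrable_imp_integrable[OF X_meas assms(6)])
  have win: "window X m t \<omega> ! h = X (t + real h) \<omega>" if "h \<le> m" for h \<omega>
    using that unfolding window_def by (subst nth_map) (auto simp: nth_append)
  \<comment> \<open>Every component is an integrable variable shifted by constants, with
    \<open>a = 0\<close> for the mean. On a probability space its zero expectation amounts to an
    equation between the true moment and the moment formula at \<open>\<beta>\<close>.\<close>
  have shift: "has_bochner_integral M (\<lambda>\<omega>. Y \<omega> - a + b) 0 \<longleftrightarrow> expectation Y = a - b"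
    if "integrable M Y" for Y and a b :: real
    using that by (auto simp: has_bochner_integral_iff prob_space)
  have E: "has_bochner_integral M (\<lambda>\<omega>. f_X m (window X m t \<omega>) \<beta> ! 0) 0 \<longleftrightarrow>
      \<mu> / (B * (\<alpha> - 1)) = \<mu>\<^sub>0 / (B\<^sub>0 * (\<alpha>\<^sub>0 - 1))"
    using shift[OF X1, of 0 "\<mu> / (B * (\<alpha> - 1))"] moments(1)[of 0 t]
    by (auto simp: f_X_def f_E_def \<beta> win)
  have var: "has_bochner_integral M (\<lambda>\<omega>. f_X m (window X m t \<omega>) \<beta> ! 1) 0 \<longleftrightarrow>
      (\<mu>\<^sub>0 / (B\<^sub>0 * (\<alpha>\<^sub>0 - 1)))\<^sup>2 - v\<^sub>0 / (2 * B\<^sub>0 * (\<alpha>\<^sub>0 - 1)) = (\<mu> / (B * (\<alpha> - 1)))\<^sup>2 - v / (2 * B * (\<alpha> - 1))"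
    unfolding moments(2)[of 0 t, OF order_refl, symmetric] shift[OF assms(6), symmetric]
    by (simp add: f_X_def f_var_def \<beta> win)
  \<comment> \<open>Positions \<open>0\<close> and \<open>1\<close> are taken by mean and variance,
    so lag \<open>h\<close> stands at position \<open>h + 1\<close>.\<close>
  have lag: "has_bochner_integral M (\<lambda>\<omega>. f_X m (window X m t \<omega>) \<beta> ! (h + 1)) 0 \<longleftrightarrow>
      (\<mu>\<^sub>0 / (B\<^sub>0 * (\<alpha>\<^sub>0 - 1)))\<^sup>2 - v\<^sub>0 * (1 - B\<^sub>0 * real h) powr (1 - \<alpha>\<^sub>0) / (2 * B\<^sub>0 * (\<alpha>\<^sub>0 - 1)) =
      (\<mu> / (B * (\<alpha> - 1)))\<^sup>2 - v * (1 - B * real h) powr (1 - \<alpha>) / (2 * B * (\<alpha> - 1))"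
    if h: "1 \<le> h" "h \<le> m" for h
  proof -
    have "f_X m (window X m t \<omega>) \<beta> ! (h + 1) = X t \<omega> * X (t + real h) \<omega> - (\<mu> / (B * (\<alpha> - 1)))\<^sup>2 +
        v * (1 - B * real h) powr (1 - \<alpha>) / (2 * B * (\<alpha> - 1))" for \<omega>
    proof -
      obtain j where j: "h = Suc j" using h(1) by (cases h) auto
      have "[1..<m + 1] ! j = h" using h j by (subst nth_upt) auto
      then have "map (\<lambda>h. f_lag h (window X m t \<omega>) \<beta>) [1..<m + 1] ! j = f_lag h (window X m t \<omega>) \<beta>"
        using h j by (subst nth_map) auto
      then show ?thesis using h by (simp add: f_X_def f_lag_def \<beta> win j)
    qed
    then show ?thesis
      unfolding moments(4)[of "real h" t, OF of_nat_0_le_iff, symmetric]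
        shift[OF moments(3)[of "real h" t, OF of_nat_0_le_iff], symmetric] by simp
  qed
  show "(\<forall>i<m + 2. has_bochner_integral M (\<lambda>\<omega>. f_X m (window X m t \<omega>) \<beta> ! i) 0) \<longleftrightarrow> \<beta> = \<beta>\<^sub>0"
  proof
    assume eqs: "\<forall>i<m + 2. has_bochner_integral M (\<lambda>\<omega>. f_X m (window X m t \<omega>) \<beta> ! i) 0"
    \<comment> \<open>With equal means the squared means cancel from the remaining equations, which
      then compare variances and autocovariances alone.\<close>
    have mean: "\<mu> / (B * (\<alpha> - 1)) = \<mu>\<^sub>0 / (B\<^sub>0 * (\<alpha>\<^sub>0 - 1))"
      using eqs E by simp
    have "v / (2 * B * (\<alpha> - 1)) = v\<^sub>0 / (2 * B\<^sub>0 * (\<alpha>\<^sub>0 - 1))"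
      using eqs[rule_format, of 1] var unfolding mean by simp
    moreover have "v * (1 - B * h) powr (1 - \<alpha>) / (2 * B * (\<alpha> - 1)) =
        v\<^sub>0 * (1 - B\<^sub>0 * h) powr (1 - \<alpha>\<^sub>0) / (2 * B\<^sub>0 * (\<alpha>\<^sub>0 - 1))" if "h \<in> {1, 2}" for h :: real
    proof -
      \<comment> \<open>Both lags needed for identification lie in the window since
        \<open>2 \<le> m\<close>.\<close>
      obtain n :: nat where n: "h = real n" "1 \<le> n" "n \<le> m"
        using \<open>h \<in> {1, 2}\<close> \<open>2 \<le> m\<close> that[of 1] that[of 2] by auto
      show ?thesis
        using eqs[rule_format, of "n + 1"] lag[OF n(2,3)] n unfolding mean by simp
    qed
    ultimately show "\<beta> = \<beta>\<^sub>0"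
      unfolding \<beta> \<beta>\<^sub>0 by (intro moment_equations_identify \<beta>_pos \<beta>\<^sub>0_pos mean)
  next
    assume "\<beta> = \<beta>\<^sub>0"
    then have eq: "\<mu> = \<mu>\<^sub>0" "v = v\<^sub>0" "\<alpha> = \<alpha>\<^sub>0" "B = B\<^sub>0" by (auto simp: \<beta> \<beta>\<^sub>0)
    show "\<forall>i<m + 2. has_bochner_integral M (\<lambda>\<omega>. f_X m (window X m t \<omega>) \<beta> ! i) 0"
    proof (intro allI impI)
      fix i assume "i < m + 2"
      then consider "i = 0" | "i = 1" | h where "i = h + 1" "1 \<le> h" "h \<le> m"
        by (cases i; cases "i - 1") auto
      then show "has_bochner_integral M (\<lambda>\<omega>. f_X m (window X m t \<omega>) \<beta> ! i) 0"
        using E var lag eq by cases simp_all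
    qed
  qed
qed

end
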